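(* Let $(\mathbb{V},\rho)$ be a (finite-dimensional) real linear representation of $\mathrm{SO}(2)$ which decomposes as $$\mathbb{V}\simeq \nu_0\,\mathbb{H}^0(\mathbb{R}^2)\oplus\mathbb{H}^{n_1}(\mathbb{R}^2)\oplus\dots\oplus\mathbb{H}^{n_r}(\mathbb{R}^2),\qquad \nu_0\in\mathbb{N},\quad n_k\in\mathbb{N}^*=\{1,2,\dots\},$$ (repetitions among the $n_k$ allowed). Let $\lambda_1,\dots,\lambda_{\nu_0}$ be the real coordinates on the factors $\mathbb{H}^0$ and $z_1,\dots,z_r$ the complex coordinates on the factors $\mathbb{H}^{n_1},\dots,\mathbb{H}^{n_r}$. Let $\mathbf{m}_1,\dots,\mathbf{m}_L$ be the irreducible solutions $\mathbf{m}$ of the Diophantine equation $$n_1\alpha_1+\dots+n_r\alpha_r-n_1\beta_1-\dots-n_r\beta_r=0,\qquad \alpha_i,\beta_i\in\mathbb{N},$$ viewed as monomials, such that $\mathbf{m}\ne\overline{\mathbf{m}}$, with one representative chosen in each pair $\{\mathbf{m},\overline{\mathbf{m}}\}$. Then a minimal integrity basis of $\mathrm{Inv}(\mathbb{V},\mathrm{SO}(2))$ consists of the homogeneous invariants $$\lambda_i,\quad |z_k|^2,\quad \mathrm{Re}(\mathbf{m}_l),\quad \mathrm{Im}(\mathbf{m}_l),\qquad 1\le i\le\nu_0,\ 1\le k\le r,\ 1\le l\le L .$$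
   Context: $\mathrm{SO}(2)$ is the group of plane rotations $r_\theta$. $\mathbb{H}^0(\mathbb{R}^2)=\mathbb{R}$ is the trivial representation; for $n\ge1$, $\mathbb{H}^n(\mathbb{R}^2)$ is the real two-dimensional irreducible representation on which $r_\theta$ acts as the rotation of angle $n\theta$ (it is realized by totally symmetric traceless tensors of order $n$). A point with components $(a,b)$ in $\mathbb{H}^n$ is encoded by the complex number $a+ib$, so that $r_\theta$ acts on the coordinate $z_k$ of $\mathbb{H}^{n_k}$ by $z_k\mapsto e^{in_k\theta}z_k$. $\mathrm{Inv}(\mathbb{V},G)$ is the algebra of real polynomial functions $p$ on $\mathbb{V}$ with $g\star p=p$ for all $g\in G$, where $(g\star p)(v)=p(\rho(g)^{-1}v)$. An integrity basis is a finite set of homogeneous invariants generating this algebra; it is minimal if no proper subset is an integrity basis. To $(\alpha_1,\dots,\alpha_r,\beta_1,\dots,\beta_r)\in\mathbb{N}^{2r}$ is associated the monomial $\mathbf{m}=z_1^{\alpha_1}\cdots z_r^{\alpha_r}\overline{z}_1^{\beta_1}\cdots\overline{z}_r^{\beta_r}$. A (non-zero) solution of the Diophantine equation is irreducible if it is not the sum of two non-trivial (non-zero) solutions in $\mathbb{N}^{2r}$; solutions are identified with their monomials. *)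

theory Defs
  imports "HOL-Analysis.Analysis" "HOL-Library.Function_Algebras"
begin

section \<open>Representations of SO(2)\<close>

definition SO2 :: "(real^2^2) set" where
  "SO2 = {A. rotation_matrix A}"

definition rot :: "real \<Rightarrow> real^2^2" where
  "rot \<theta> = vector [vector [cos \<theta>, - sin \<theta>], vector [sin \<theta>, cos \<theta>]]"

lemma SO2_eq_range_rot: "SO2 = range rot"
proof
  show "range rot \<subseteq> SO2"
    by (auto simp: SO2_def rot_def rotation_matrix_def orthogonal_matrix_def det_2
        matrix_matrix_mult_def transpose_def mat_def vec_eq_iff forall_2 sum_2
        simp flip: power2_eq_square)
  show "SO2 \<subseteq> range rot"
  proof
    fix A assume "A \<in> SO2"
    then have o: "transpose A ** A = mat 1" and d: "det A = 1"
      by (auto simp: SO2_def rotation_matrix_def orthogonal_matrix_def)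
    define a b c e where abce: "a = A$1$1" "b = A$1$2" "c = A$2$1" "e = A$2$2"
    have 1: "a * a + c * c = 1" "a * b + c * e = 0" "b * b + e * e = 1"
      using o by (auto simp: abce matrix_matrix_mult_def transpose_def mat_def vec_eq_iff
          forall_2 sum_2)
    have 2: "a * e - b * c = 1" using d by (simp add: det_2 abce)
    have "(a - e)\<^sup>2 + (b + c)\<^sup>2 = (a*a + c*c) + (b*b + e*e) - 2 * (a*e - b*c)"
      by (simp add: power2_eq_square algebra_simps)
    then have "(a - e)\<^sup>2 + (b + c)\<^sup>2 = 0" using 1 2 by simp
    then have 3: "e = a" "b = - c" by (auto simp: sum_power2_eq_zero_iff)
    obtain t where "a = cos t" "c = sin t"
      using sincos_total_2pi[of a c] 1(1) by (auto simp: power2_eq_square)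
    with 3 abce have "A = rot t"
      by (simp add: rot_def vec_eq_iff forall_2)
    then show "A \<in> range rot" by blast
  qed
qed

definition real_representation :: "(real^'m^'m) set \<Rightarrow> (real^'m^'m \<Rightarrow> 'v::real_vector \<Rightarrow> 'v) \<Rightarrow> bool" where
  "real_representation G \<rho> \<longleftrightarrow>
     (\<forall>g\<in>G. linear (\<rho> g)) \<and> \<rho> (mat 1) = id \<and> (\<forall>g\<in>G. \<forall>h\<in>G. \<rho> (g ** h) = \<rho> g \<circ> \<rho> h)"

text \<open>
  An equivariant linear isomorphism from \<open>V\<close> onto \<open>\<real>^\<nu>\<^sub>0 \<times> \<complex>^r\<close>, given by its components:
  the coordinates \<open>lam i\<close> on the copies of the trivial representation and the complex coordinates
  \<open>z k\<close> on the summands of weight \<open>n k\<close>. All indices start at 0. In particular \<open>V\<close> is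
  finite-dimensional, and \<open>\<nu>\<^sub>0 = 0\<close> or \<open>r = 0\<close> is allowed.
\<close>
definition harmonic_coordinates ::
    "(real^2^2 \<Rightarrow> 'v::real_vector \<Rightarrow> 'v) \<Rightarrow> nat \<Rightarrow> nat \<Rightarrow> (nat \<Rightarrow> nat) \<Rightarrow>
     (nat \<Rightarrow> 'v \<Rightarrow> real) \<Rightarrow> (nat \<Rightarrow> 'v \<Rightarrow> complex) \<Rightarrow> bool" where
  "harmonic_coordinates \<rho> \<nu>\<^sub>0 r n lam z \<longleftrightarrow>
     (\<forall>i<\<nu>\<^sub>0. linear (lam i) \<and> (\<forall>\<theta> v. lam i (\<rho> (rot \<theta>) v) = lam i v)) \<and>
     (\<forall>k<r. linear (z k) \<and> (\<forall>\<theta> v. z k (\<rho> (rot \<theta>) v) = exp (\<i> * of_nat (n k) * of_real \<theta>) * z k v)) \<and>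
     bij_betw (\<lambda>v. (\<lambda>i\<in>{..<\<nu>\<^sub>0}. lam i v, \<lambda>k\<in>{..<r}. z k v)) UNIV
       (({..<\<nu>\<^sub>0} \<rightarrow>\<^sub>E UNIV) \<times> ({..<r} \<rightarrow>\<^sub>E UNIV))"


section \<open>Polynomial invariants\<close>

text \<open>The unital real algebra of functions generated by a set of functions.\<close>
inductive_set algebra_gen :: "('v \<Rightarrow> real) set \<Rightarrow> ('v \<Rightarrow> real) set" for S where
  gen: "f \<in> S \<Longrightarrow> f \<in> algebra_gen S"
| const: "(\<lambda>v. c) \<in> algebra_gen S"
| add: "f \<in> algebra_gen S \<Longrightarrow> g \<in> algebra_gen S \<Longrightarrow> (\<lambda>v. f v + g v) \<in> algebra_gen S"
| mult: "f \<in> algebra_gen S \<Longrightarrow> g \<in> algebra_gen S \<Longrightarrow> (\<lambda>v. f v * g v) \<in> algebra_gen S"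

text \<open>
  Real polynomial functions on a real vector space that carries no norm (and may be zero); on
  Euclidean spaces this is the library notion.
\<close>
definition polynomial_functions :: "('v::real_vector \<Rightarrow> real) set" where
  "polynomial_functions = algebra_gen {f. linear f}"

lemma polynomial_functions_iff_real_polynomial_function:
  fixes f :: "'v::euclidean_space \<Rightarrow> real"
  shows "f \<in> polynomial_functions \<longleftrightarrow> real_polynomial_function f"
proof
  assume "f \<in> polynomial_functions"
  then show "real_polynomial_function f"
    unfolding polynomial_functions_def
    by induction (auto simp: linear_conv_bounded_linear)
next
  assume "real_polynomial_function f"
  then show "f \<in> polynomial_functions"
    unfolding polynomial_functions_def
    by induction (auto intro: algebra_gen.intros simp: linear_conv_bounded_linear)
qed

definition act :: "('g \<Rightarrow> 'v \<Rightarrow> 'v) \<Rightarrow> 'g \<Rightarrow> ('v \<Rightarrow> real) \<Rightarrow> 'v \<Rightarrow> real" where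
  "act \<rho> g p = (\<lambda>v. p (inv (\<rho> g) v))"

definition Inv :: "'g set \<Rightarrow> ('g \<Rightarrow> 'v::real_vector \<Rightarrow> 'v) \<Rightarrow> ('v \<Rightarrow> real) set" where
  "Inv G \<rho> = {p \<in> polynomial_functions. \<forall>g\<in>G. act \<rho> g p = p}"

definition homogeneous :: "('v::real_vector \<Rightarrow> real) \<Rightarrow> bool" where
  "homogeneous p \<longleftrightarrow> (\<exists>d. \<forall>t v. p (t *\<^sub>R v) = t ^ d * p v)"

definition integrity_basis :: "'g set \<Rightarrow> ('g \<Rightarrow> 'v::real_vector \<Rightarrow> 'v) \<Rightarrow> ('v \<Rightarrow> real) set \<Rightarrow> bool" where
  "integrity_basis G \<rho> S \<longleftrightarrow>
     finite S \<and> S \<subseteq> Inv G \<rho> \<and> (\<forall>p\<in>S. homogeneous p) \<and> algebra_gen S = Inv G \<rho>"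

definition minimal_integrity_basis ::
    "'g set \<Rightarrow> ('g \<Rightarrow> 'v::real_vector \<Rightarrow> 'v) \<Rightarrow> ('v \<Rightarrow> real) set \<Rightarrow> bool" where
  "minimal_integrity_basis G \<rho> S \<longleftrightarrow>
     integrity_basis G \<rho> S \<and> \<not> (\<exists>T. T \<subset> S \<and> integrity_basis G \<rho> T)"


section \<open>The Diophantine equation and its monomials\<close>

text \<open>
  A tuple \<open>(\<alpha>, \<beta>) \<in> \<nat>^(2r)\<close> is a pair of sequences that vanish from index \<open>r\<close> on; addition and zero
  are pointwise.
\<close>
type_synonym exponents = "(nat \<Rightarrow> nat) \<times> (nat \<Rightarrow> nat)"

definition solutions :: "nat \<Rightarrow> (nat \<Rightarrow> nat) \<Rightarrow> exponents set" where
  "solutions r n = {(\<alpha>, \<beta>). (\<forall>k\<ge>r. \<alpha> k = 0 \<and> \<beta> k = 0) \<and>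
     (\<Sum>k<r. int (n k) * int (\<alpha> k)) - (\<Sum>k<r. int (n k) * int (\<beta> k)) = 0}"

definition irreducible_solutions :: "nat \<Rightarrow> (nat \<Rightarrow> nat) \<Rightarrow> exponents set" where
  "irreducible_solutions r n = {s \<in> solutions r n. s \<noteq> 0 \<and>
     \<not> (\<exists>s1 \<in> solutions r n. \<exists>s2 \<in> solutions r n. s1 \<noteq> 0 \<and> s2 \<noteq> 0 \<and> s = s1 + s2)}"

definition monomial :: "nat \<Rightarrow> (nat \<Rightarrow> 'v \<Rightarrow> complex) \<Rightarrow> exponents \<Rightarrow> 'v \<Rightarrow> complex" where
  "monomial r z = (\<lambda>(\<alpha>, \<beta>) v. (\<Prod>k<r. z k v ^ \<alpha> k) * (\<Prod>k<r. cnj (z k v) ^ \<beta> k))"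

text \<open>Complex conjugation of monomials exchanges \<open>\<alpha>\<close> and \<open>\<beta>\<close>.\<close>
definition conj_exponents :: "exponents \<Rightarrow> exponents" where
  "conj_exponents = prod.swap"

lemma monomial_conj_exponents: "monomial r z (conj_exponents s) v = cnj (monomial r z s v)"
  by (cases s) (simp add: monomial_def conj_exponents_def mult.commute)

text \<open>
  \<open>M\<close> consists of irreducible solutions that differ from their conjugates, exactly one from each
  conjugate pair.
\<close>
definition conj_representatives :: "nat \<Rightarrow> (nat \<Rightarrow> nat) \<Rightarrow> exponents set \<Rightarrow> bool" where
  "conj_representatives r n M \<longleftrightarrow>
     M \<subseteq> {s \<in> irreducible_solutions r n. s \<noteq> conj_exponents s} \<and>
     (\<forall>s \<in> irreducible_solutions r n. s \<noteq> conj_exponents s \<longrightarrow> (\<exists>!t. t \<in> M \<and> t \<in> {s, conj_exponents s}))"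

end

theory Submission
  imports Defs
begin

text \<open>
  In harmonic coordinates every polynomial function is, in exactly one way, a complex linear
  combination of monomials \<open>\<lambda>\<^sup>\<gamma> z\<^sup>\<alpha> cnj z\<^sup>\<beta>\<close>. Uniqueness holds because these monomials are
  multiplicative for the coordinatewise product on the representation space and distinct
  multiplicative functions are linearly independent (Dedekind's argument,
  \<open>distinct_multiplicative_functions_independent\<close>). So every polynomial function has well-defined
  coefficients, and all that follows is read off from them.

  The rotation by \<open>\<theta>\<close> multiplies a monomial by \<open>cis (\<theta> * w)\<close>, where \<open>w\<close> is the left-hand side of the
  Diophantine equation. Comparing coefficients, an invariant involves only monomials with \<open>w = 0\<close>
  (\<open>rotation_invariant_in_invariant_polys\<close>), that is, products of the coordinates \<open>\<lambda>\<close> with monomials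
  of solutions. A solution is a sum of irreducible ones, so its monomial is a product of irreducible
  monomials; these are \<open>m\<close> or \<open>cnj m\<close> for a chosen representative \<open>m\<close>, or, if they equal their own
  conjugate, \<open>\<bar>z\<^sub>k\<bar>\<^sup>2\<close>. Taking real parts shows that the listed functions generate
  (\<open>Inv_subset_algebra_gen\<close>). There are finitely many of them because the exponents of an irreducible
  solution are bounded (\<open>finite_irreducible_solutions\<close>).

  For minimality let \<open>m\<close> be a nonzero index of weight zero that is not a sum of two nonzero ones. In a
  product of two invariants the monomial \<open>m\<close> arises only as \<open>1 \<cdot> m\<close> or \<open>m \<cdot> 1\<close>, so the coefficient of \<open>m\<close> is a
  derivation at the origin, \<open>L (f g) = f 0 * L g + L f * g 0\<close> (\<open>coeff_mult\<close>). The invariants on which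
  such an \<open>L\<close> vanishes therefore form a subalgebra, and the same holds for the real part of a complex
  multiple of \<open>L\<close>. For each listed function one such functional is nonzero on it and zero on all
  the others (\<open>generator_separated\<close>), so it is not a polynomial in the others.
\<close>

section \<open>Linear independence of multiplicative functions\<close>

text \<open>
  Dedekind's argument: comparing a relation at \<open>pr w v\<close> with \<open>\<phi>0 w\<close> times the same relation at \<open>v\<close>
  eliminates \<open>\<phi>0\<close> and leaves a relation among fewer functions.
\<close>
lemma distinct_multiplicative_functions_independent:
  fixes pr :: "'v \<Rightarrow> 'v \<Rightarrow> 'v" and B :: "('v \<Rightarrow> 'k::field) set"
  assumes "finite B"
    and "\<And>\<phi> v w. \<phi> \<in> B \<Longrightarrow> \<phi> (pr v w) = \<phi> v * \<phi> w"
    and "\<And>\<phi>. \<phi> \<in> B \<Longrightarrow> \<exists>v. \<phi> v \<noteq> 0"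
    and "\<And>v. (\<Sum>\<phi>\<in>B. c \<phi> * \<phi> v) = 0"
  shows "\<forall>\<phi>\<in>B. c \<phi> = 0"
  using assms
proof (induction B arbitrary: c rule: finite_induct)
  case (insert \<phi>0 B)
  have sum0: "c \<phi>0 * \<phi>0 v + (\<Sum>\<phi>\<in>B. c \<phi> * \<phi> v) = 0" for v
    using insert.prems(3)[of v] insert.hyps by simp
  have "\<forall>\<phi>\<in>B. c \<phi> * (\<phi> w - \<phi>0 w) = 0" for w
  proof (rule insert.IH)
    show "(\<Sum>\<phi>\<in>B. c \<phi> * (\<phi> w - \<phi>0 w) * \<phi> v) = 0" for v
    proof -
      have "(\<Sum>\<phi>\<in>B. c \<phi> * (\<phi> w - \<phi>0 w) * \<phi> v)
          = (\<Sum>\<phi>\<in>B. c \<phi> * \<phi> (pr w v)) - \<phi>0 w * (\<Sum>\<phi>\<in>B. c \<phi> * \<phi> v)"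
        unfolding sum_distrib_left sum_subtractf [symmetric]
        by (intro sum.cong) (auto simp: insert.prems(1) algebra_simps)
      also have "(\<Sum>\<phi>\<in>B. c \<phi> * \<phi> (pr w v)) = - (c \<phi>0 * \<phi>0 (pr w v))"
        using sum0[of "pr w v"] by (simp add: eq_neg_iff_add_eq_0 add.commute)
      also have "(\<Sum>\<phi>\<in>B. c \<phi> * \<phi> v) = - (c \<phi>0 * \<phi>0 v)"
        using sum0[of v] by (simp add: eq_neg_iff_add_eq_0 add.commute)
      finally show ?thesis by (simp add: insert.prems(1))
    qed
  qed (use insert.prems in auto)
  moreover have "\<exists>w. \<phi> w \<noteq> \<phi>0 w" if "\<phi> \<in> B" for \<phi>
    using that insert.hyps by (metis ext)
  ultimately have B: "\<forall>\<phi>\<in>B. c \<phi> = 0"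
    by (metis eq_iff_diff_eq_0 mult_eq_0_iff)
  then have "c \<phi>0 * \<phi>0 v = 0" for v using sum0[of v] by simp
  then show ?case using B insert.prems(2) by (metis insert_iff mult_eq_0_iff)
qed simp

section \<open>Algebras of real functions and their complexification\<close>

text \<open>
  This is the complexification of the algebra generated by \<open>S\<close>. It is closed under products and
  conjugation, which makes complex monomials easier to handle than their real and imaginary parts.
\<close>
definition complexified_gen :: "('v \<Rightarrow> real) set \<Rightarrow> ('v \<Rightarrow> complex) set" where
  "complexified_gen S = {f. (\<lambda>v. Re (f v)) \<in> algebra_gen S \<and> (\<lambda>v. Im (f v)) \<in> algebra_gen S}"

lemma complexified_gen_const: "(\<lambda>v. c) \<in> complexified_gen S"
  by (simp add: complexified_gen_def algebra_gen.const)

lemma complexified_gen_of_real: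
  "f \<in> algebra_gen S \<Longrightarrow> (\<lambda>v. of_real (f v)) \<in> complexified_gen S"
  by (simp add: complexified_gen_def algebra_gen.const)

lemma complexified_gen_add:
  "f \<in> complexified_gen S \<Longrightarrow> g \<in> complexified_gen S \<Longrightarrow> (\<lambda>v. f v + g v) \<in> complexified_gen S"
  by (simp add: complexified_gen_def algebra_gen.add)

lemma complexified_gen_mult:
  assumes "f \<in> complexified_gen S" "g \<in> complexified_gen S"
  shows "(\<lambda>v. f v * g v) \<in> complexified_gen S"
proof -
  have *: "a \<in> algebra_gen S \<Longrightarrow> b \<in> algebra_gen S \<Longrightarrow> c \<in> algebra_gen S \<Longrightarrow> d \<in> algebra_gen S
     \<Longrightarrow> (\<lambda>v. a v * b v - c v * d v) \<in> algebra_gen S" for a b c d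
    using algebra_gen.add[OF algebra_gen.mult[of a S b]
        algebra_gen.mult[OF algebra_gen.const[of "-1"] algebra_gen.mult[of c S d]]]
    by simp
  show ?thesis using assms
    by (auto simp: complexified_gen_def intro!: * algebra_gen.add algebra_gen.mult)
qed

lemma complexified_gen_cnj:
  assumes "f \<in> complexified_gen S"
  shows "(\<lambda>v. cnj (f v)) \<in> complexified_gen S"
  using assms algebra_gen.mult[OF algebra_gen.const[of "-1"], of "\<lambda>v. Im (f v)" S]
  by (simp add: complexified_gen_def)

lemma complexified_gen_prod_power:
  assumes "\<And>k. k < m \<Longrightarrow> f k \<in> complexified_gen S"
  shows "(\<lambda>v. \<Prod>k<(m::nat). f k v ^ a k) \<in> complexified_gen S"
proof -
  have pow: "(\<lambda>v. g v ^ j) \<in> complexified_gen S" if "g \<in> complexified_gen S" for g j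
  proof (induction j)
    case (Suc j)
    then show ?case using complexified_gen_mult[OF that] by simp
  qed (simp add: complexified_gen_const)
  show ?thesis
    using assms
  proof (induction m)
    case (Suc m)
    then show ?case by (auto intro!: complexified_gen_mult pow)
  qed (simp add: complexified_gen_const)
qed

section \<open>Complex linear combinations of functions\<close>

text \<open>
  The complex vector space of complex-valued functions on a set: it supplies spans, independence
  and coordinates with respect to an independent family.
\<close>
interpretation cfun: vector_space "\<lambda>(c::complex) (f::'v \<Rightarrow> complex) v. c * f v"
  by standard (auto simp: fun_eq_iff algebra_simps)

lemma sum_fun_apply: "(\<Sum>x\<in>A. f x) v = (\<Sum>x\<in>A. f x v)"
  for f :: "'a \<Rightarrow> 'v \<Rightarrow> 'b::comm_monoid_add"
  by (induction A rule: infinite_finite_induct) auto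

lemma span_image_induct [consumes 1, case_names zero step]:
  assumes "f \<in> cfun.span (e ` X)"
    and zero: "P (\<lambda>v. 0)"
    and step: "\<And>c x g. x \<in> X \<Longrightarrow> g \<in> cfun.span (e ` X) \<Longrightarrow> P g \<Longrightarrow> P (\<lambda>v. c * e x v + g v)"
  shows "P f"
proof -
  have "f \<in> cfun.span (e ` X) \<and> P f"
    using assms(1)
  proof (induction rule: cfun.span_induct_alt)
    case base
    show ?case using zero cfun.span_zero[of "e ` X"] by (simp add: zero_fun_def)
  next
    case (step c b g)
    then obtain x where x: "x \<in> X" "b = e x" by blast
    have "(\<lambda>v. c * b v) + g \<in> cfun.span (e ` X)"
      using step by (intro cfun.span_add cfun.span_scale) (auto intro: cfun.span_base)
    then show ?case using assms(3)[of x g c] x step by (simp add: plus_fun_def)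
  qed
  then show ?thesis ..
qed

lemma span_zero_fun: "(\<lambda>v. 0) \<in> cfun.span S"
  using cfun.span_zero[of S] by (simp add: zero_fun_def)

lemma span_add_fun: "f \<in> cfun.span S \<Longrightarrow> g \<in> cfun.span S \<Longrightarrow> (\<lambda>v. f v + g v) \<in> cfun.span S"
  using cfun.span_add[of f S g] by (simp add: plus_fun_def)

lemma span_sum_fun: "(\<And>i. i \<in> I \<Longrightarrow> f i \<in> cfun.span S) \<Longrightarrow> (\<lambda>v. \<Sum>i\<in>I. f i v) \<in> cfun.span S"
  using cfun.span_sum[of I f S] by (simp add: sum_fun_apply[abs_def])

section \<open>Irreducible solutions of the Diophantine equation\<close>

definition unit_exponent :: "nat \<Rightarrow> nat \<Rightarrow> nat" where
  "unit_exponent k = (\<lambda>j. if j = k then 1 else 0)"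

lemma sum_unit_exponent:
  "(\<Sum>j<r. f j * (c * unit_exponent k j)) = (if k < r then f k * c else 0)"
proof -
  have "(\<Sum>j<r. f j * (c * unit_exponent k j)) = (\<Sum>j<r. if j = k then f k * c else 0)"
    by (intro sum.cong) (auto simp: unit_exponent_def)
  then show ?thesis by simp
qed

lemma solutions_iff:
  "s \<in> solutions r n \<longleftrightarrow> (\<forall>k\<ge>r. fst s k = 0 \<and> snd s k = 0) \<and>
     (\<Sum>k<r. n k * fst s k) = (\<Sum>k<r. n k * snd s k)"
proof -
  have "(\<Sum>k<r. int (n k) * int (a k)) - (\<Sum>k<r. int (n k) * int (b k)) = 0
      \<longleftrightarrow> (\<Sum>k<r. n k * a k) = (\<Sum>k<r. n k * b k)" for a b
    unfolding right_minus_eq of_nat_mult [symmetric] of_nat_sum [symmetric] of_nat_eq_iff ..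
  then show ?thesis by (cases s)
    (simp only: solutions_def mem_Collect_eq case_prod_conv fst_conv snd_conv)
qed

lemma zero_in_solutions: "0 \<in> solutions r n"
  by (simp add: solutions_iff)

lemma solutions_add: "s \<in> solutions r n \<Longrightarrow> t \<in> solutions r n \<Longrightarrow> s + t \<in> solutions r n"
  by (auto simp: solutions_iff algebra_simps sum.distrib)

lemma solutions_conj: "s \<in> solutions r n \<Longrightarrow> conj_exponents s \<in> solutions r n"
  by (auto simp: solutions_iff conj_exponents_def)

text \<open>
  Splitting a reducible solution strictly lowers the total degree of both parts, so a property that
  holds for irreducible solutions and is additive holds for all solutions.
\<close>
lemma solutions_factorize [consumes 1, case_names zero irreducible sum]:
  assumes "s \<in> solutions r n"
    and zero: "P 0"
    and irreducible: "\<And>s. s \<in> irreducible_solutions r n \<Longrightarrow> P s"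
    and sum: "\<And>s t. P s \<Longrightarrow> P t \<Longrightarrow> P (s + t)"
  shows "P s"
  using assms(1)
proof (induction "\<Sum>k<r. fst s k + snd s k" arbitrary: s rule: less_induct)
  case less
  consider "s = 0" | "s \<in> irreducible_solutions r n"
    | t u where "t \<in> solutions r n" "u \<in> solutions r n" "t \<noteq> 0" "u \<noteq> 0" "s = t + u"
    using less.prems unfolding irreducible_solutions_def by blast
  then show ?case
  proof cases
    case 3
    have pos: "(\<Sum>k<r. fst t k + snd t k) > 0" if "t \<in> solutions r n" "t \<noteq> 0" for t
    proof (rule ccontr)
      assume "\<not> ?thesis"
      then have "\<forall>k<r. fst t k = 0 \<and> snd t k = 0" by auto
      then have "fst t k = 0" "snd t k = 0" for k
        using that(1) by (cases "k < r"; auto simp: solutions_iff)+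
      with that(2) show False by (auto simp: prod_eq_iff fun_eq_iff)
    qed
    have "(\<Sum>k<r. fst s k + snd s k) = (\<Sum>k<r. fst t k + snd t k) + (\<Sum>k<r. fst u k + snd u k)"
      using 3(5) by (simp add: sum.distrib)
    then show ?thesis
      using 3 pos[of t] pos[of u] less.hyps[of t] less.hyps[of u] sum by auto
  qed (use zero irreducible in auto)
qed

text \<open>
  The equation is linear, so the difference of two comparable solutions is again a solution, and an
  irreducible one cannot lie strictly above a nonzero one.
\<close>
lemma irreducible_solution_minimal:
  assumes s: "s \<in> irreducible_solutions r n" and t: "t \<in> solutions r n" "t \<noteq> 0"
    and le: "\<And>k. fst t k \<le> fst s k" "\<And>k. snd t k \<le> snd s k"
  shows "t = s"
proof -
  define u where "u = (\<lambda>k. fst s k - fst t k, \<lambda>k. snd s k - snd t k)"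
  have su: "s = t + u" using le by (auto simp: u_def prod_eq_iff fun_eq_iff)
  have "s \<in> solutions r n" using s by (simp add: irreducible_solutions_def)
  with t(1) have "u \<in> solutions r n"
    unfolding su by (auto simp: solutions_iff algebra_simps sum.distrib)
  with s t su have "u = 0" unfolding irreducible_solutions_def by blast
  with su show ?thesis by simp
qed

lemma unit_pair_irreducible:
  assumes "k < r" "1 \<le> n k"
  shows "(unit_exponent k, unit_exponent k) \<in> irreducible_solutions r n"
proof -
  let ?e = "unit_exponent k"
  have zero: "u = 0"
    if u: "u \<in> solutions r n" "\<And>j. fst u j \<le> ?e j" "\<And>j. snd u j \<le> ?e j" "fst u k = 0" for u
  proof -
    have f0: "fst u j = 0" for j
      using u(2)[of j] u(4) by (cases "j = k") (auto simp: unit_exponent_def)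
    then have "(\<Sum>j<r. n j * snd u j) = 0" using u(1) by (simp add: solutions_iff)
    then have "snd u k = 0" using assms by force
    then have "snd u j = 0" for j
      using u(3)[of j] by (cases "j = k") (auto simp: unit_exponent_def)
    with f0 show "u = 0" by (simp add: prod_eq_iff fun_eq_iff)
  qed
  have "s = 0 \<or> t = 0" if "s \<in> solutions r n" "t \<in> solutions r n" "(?e, ?e) = s + t" for s t
  proof -
    have eq: "fst s j + fst t j = ?e j" "snd s j + snd t j = ?e j" for j
      using arg_cong[OF that(3), of "\<lambda>u. fst u j"] arg_cong[OF that(3), of "\<lambda>u. snd u j"] by simp_all
    have le: "fst s j \<le> ?e j" "snd s j \<le> ?e j" "fst t j \<le> ?e j" "snd t j \<le> ?e j" for j
      using eq[of j] by linarith+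
    have "fst s k = 0 \<or> fst t k = 0"
      using eq(1)[of k] by (auto simp: unit_exponent_def)
    then show ?thesis using zero[OF that(1) le(1,2)] zero[OF that(2) le(3,4)] by blast
  qed
  moreover have "(?e, ?e) \<in> solutions r n" using assms by (auto simp: solutions_iff unit_exponent_def)
  moreover have "(?e, ?e) \<noteq> 0" by (auto simp: prod_eq_iff fun_eq_iff unit_exponent_def)
  ultimately show ?thesis unfolding irreducible_solutions_def by blast
qed

text \<open>
  If \<open>\<alpha> = \<beta> \<noteq> 0\<close>, then the solution of \<open>z\<^sub>k cnj z\<^sub>k\<close> lies below \<open>(\<alpha>, \<beta>)\<close> for any \<open>k\<close> with
  \<open>\<alpha>\<^sub>k \<noteq> 0\<close>. This is why the self-conjugate irreducible monomials contribute exactly the \<open>\<bar>z\<^sub>k\<bar>\<^sup>2\<close>.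
\<close>
lemma self_conjugate_irreducible:
  assumes s: "s \<in> irreducible_solutions r n" and conj: "s = conj_exponents s"
  obtains k where "k < r" "s = (unit_exponent k, unit_exponent k)"
proof -
  have s': "s \<in> solutions r n" "s \<noteq> 0" using s by (auto simp: irreducible_solutions_def)
  have eq: "fst s = snd s" using arg_cong[OF conj, of fst] by (simp add: conj_exponents_def)
  then obtain k where k: "fst s k \<noteq> 0" using s'(2) by (auto simp: prod_eq_iff fun_eq_iff)
  then have kr: "k < r" using s'(1) unfolding solutions_iff by (meson not_le)
  have "(unit_exponent k, unit_exponent k) = s"
  proof (rule irreducible_solution_minimal[OF s])
    show "(unit_exponent k, unit_exponent k) \<in> solutions r n"
      using kr by (auto simp: solutions_iff unit_exponent_def)
    show "(unit_exponent k, unit_exponent k) \<noteq> 0"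
      by (auto simp: prod_eq_iff fun_eq_iff unit_exponent_def)
    have "snd s k \<noteq> 0" using k eq by simp
    then show "fst (unit_exponent k, unit_exponent k) j \<le> fst s j"
      "snd (unit_exponent k, unit_exponent k) j \<le> snd s j" for j
      using k by (cases "j = k"; simp add: unit_exponent_def)+
  qed
  then show thesis using that kr by blast
qed

text \<open>
  Let \<open>s = (\<alpha>, \<beta>)\<close> be irreducible. If \<open>n\<^sub>j \<le> \<alpha>\<^sub>i\<close> and \<open>n\<^sub>i \<le> \<beta>\<^sub>j\<close> for some \<open>i, j\<close>, then the solution of
  \<open>z\<^sub>i\<close> to the power \<open>n\<^sub>j\<close> times \<open>cnj z\<^sub>j\<close> to the power \<open>n\<^sub>i\<close> lies below \<open>s\<close> and hence equals it.
  Otherwise \<open>\<alpha>\<close> and \<open>\<beta>\<close> cannot both have an entry above \<open>N = \<Sum>n\<^sub>k\<close>, so one side of the equation is at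
  most \<open>N\<^sup>2\<close>; as the two sides are equal and the \<open>n\<^sub>k\<close> are positive, all entries are.
\<close>
lemma finite_irreducible_solutions:
  assumes pos: "\<And>k. k < r \<Longrightarrow> 1 \<le> n k"
  shows "finite (irreducible_solutions r n)"
proof -
  define N where "N = (\<Sum>k<r. n k)"
  define b where "b = N * N + N"
  have nN: "n k \<le> N" if "k < r" for k
    unfolding N_def using that by (intro member_le_sum) auto
  have entry: "f k \<le> (\<Sum>j<r. n j * f j)" if "k < r" for f k
  proof -
    have "f k \<le> n k * f k" using pos[OF that] by simp
    also have "\<dots> \<le> (\<Sum>j<r. n j * f j)"
      using that by (intro member_le_sum[of k "{..<r}" "\<lambda>j. n j * f j"]) auto
    finally show ?thesis .
  qed
  have total: "(\<Sum>j<r. n j * f j) \<le> N * N" if "\<And>j. j < r \<Longrightarrow> f j \<le> N" for f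
    unfolding N_def sum_distrib_right by (intro sum_mono mult_left_mono) (use that N_def in auto)
  have bound: "fst s k \<le> b \<and> snd s k \<le> b" if s: "s \<in> irreducible_solutions r n" and k: "k < r" for s k
  proof (cases "\<exists>i<r. \<exists>j<r. n j \<le> fst s i \<and> n i \<le> snd s j")
    case True
    then obtain i j where ij: "i < r" "j < r" "n j \<le> fst s i" "n i \<le> snd s j" by blast
    \<comment> \<open>The solution below \<open>s\<close>: both sides of the equation are \<open>n i * n j\<close>.\<close>
    define t where "t = (\<lambda>l. n j * unit_exponent i l, \<lambda>l. n i * unit_exponent j l)"
    have "t = s"
    proof (rule irreducible_solution_minimal[OF s])
      show "t \<in> solutions r n"
        using ij sum_unit_exponent[of n "n j" i r] sum_unit_exponent[of n "n i" j r]
        by (auto simp: t_def solutions_iff unit_exponent_def)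
      show "t \<noteq> 0" using pos[OF ij(2)]
        by (auto simp: t_def prod_eq_iff fun_eq_iff unit_exponent_def)
    qed (use ij in \<open>auto simp: t_def unit_exponent_def\<close>)
    then have "fst s k \<le> N" "snd s k \<le> N"
      using nN[OF ij(1)] nN[OF ij(2)] by (auto simp: t_def unit_exponent_def)
    then show ?thesis by (simp add: b_def)
  next
    case False
    have bal: "(\<Sum>j<r. n j * fst s j) = (\<Sum>j<r. n j * snd s j)"
      using s by (auto simp: irreducible_solutions_def solutions_iff)
    have "(\<forall>i<r. fst s i \<le> N) \<or> (\<forall>j<r. snd s j \<le> N)"
    proof (rule ccontr)
      assume "\<not> ?thesis"
      then obtain i j where "i < r" "j < r" "N < fst s i" "N < snd s j" by (auto simp: not_le)
      then show False using False nN[of i] nN[of j] by (meson less_imp_le order_trans)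
    qed
    then have "(\<Sum>j<r. n j * fst s j) \<le> N * N" using total[of "fst s"] total[of "snd s"] bal by auto
    then show ?thesis
      using entry[OF k, of "fst s"] entry[OF k, of "snd s"] bal by (simp add: b_def)
  qed
  define F where "F = {f. \<forall>k. (k \<in> {..<r} \<longrightarrow> f k \<in> {..b}) \<and> (k \<notin> {..<r} \<longrightarrow> f k = (0::nat))}"
  have "finite F" unfolding F_def by (intro finite_set_of_finite_funs) auto
  moreover have "irreducible_solutions r n \<subseteq> F \<times> F"
  proof
    fix s assume s: "s \<in> irreducible_solutions r n"
    then have "\<forall>k\<ge>r. fst s k = 0 \<and> snd s k = 0"
      by (simp add: irreducible_solutions_def solutions_iff)
    then show "s \<in> F \<times> F" using bound[OF s] by (simp add: F_def mem_Times_iff)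
  qed
  ultimately show ?thesis by (meson finite_SigmaI finite_subset)
qed

text \<open>
  A representative and its conjugate would be two representatives of one conjugate pair.
\<close>
lemma conj_representatives_disjoint:
  assumes M: "conj_representatives r n M" and "s \<in> M" "t \<in> M"
  shows "s \<noteq> conj_exponents t"
proof
  assume eq: "s = conj_exponents t"
  have t: "t \<in> irreducible_solutions r n" "t \<noteq> conj_exponents t"
    using M \<open>t \<in> M\<close> unfolding conj_representatives_def by blast+
  then have "\<exists>!u. u \<in> M \<and> u \<in> {t, conj_exponents t}"
    using M unfolding conj_representatives_def by blast
  then have "s = t" using \<open>s \<in> M\<close> \<open>t \<in> M\<close> eq by blast
  with eq t(2) show False by simp
qed

section \<open>Identities for powers, phases and rotations\<close>

lemma cis_power_eq_imp_eq:
  assumes "\<And>t. cis t ^ p = cis t ^ q"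
  shows "p = q"
proof (rule ccontr)
  assume "p \<noteq> q"
  \<comment> \<open>At this angle the two powers differ by a half turn.\<close>
  define t where "t = pi / (real p - real q)"
  have "real p * t = real q * t + pi" using \<open>p \<noteq> q\<close> by (simp add: t_def field_simps)
  then have "cis (real p * t) = - cis (real q * t)" by (simp flip: cis_mult)
  moreover have "cis (real p * t) = cis (real q * t)" using assms[of t] by (simp add: Complex.DeMoivre)
  ultimately have "2 * cis (real q * t) = 0" by (metis add.right_inverse mult_2)
  then show False by simp
qed

text \<open>
  The modulus of \<open>c ^ a * cnj c ^ b\<close> determines \<open>a + b\<close>, its argument \<open>a - b\<close>.
\<close>
lemma power_cnj_power_eq_imp_eq:
  assumes eq: "\<And>c. c ^ a * cnj c ^ b = c ^ a' * cnj c ^ b'"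
  shows "a = a' \<and> b = b'"
proof -
  have "(2::complex) ^ (a + b) = 2 ^ (a' + b')" using eq[of 2] by (simp add: power_add)
  then have "norm ((2::complex) ^ (a + b)) = norm ((2::complex) ^ (a' + b'))" by simp
  then have "(2::real) ^ (a + b) = 2 ^ (a' + b')" by (simp add: norm_power)
  then have 1: "a + b = a' + b'" by simp
  have "a + b' = a' + b"
  proof (rule cis_power_eq_imp_eq)
    fix t
    have c: "cis t ^ j * cnj (cis t) ^ j = 1" for j
      by (simp add: cis_cnj cis_mult flip: power_mult_distrib)
    have "cis t ^ (a + b') = cis t ^ b * cis t ^ b' * (cis t ^ a * cnj (cis t) ^ b)"
      using c[of b] by (simp add: power_add algebra_simps)
    also have "\<dots> = cis t ^ b * cis t ^ b' * (cis t ^ a' * cnj (cis t) ^ b')" by (simp only: eq)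
    also have "\<dots> = cis t ^ (a' + b)"
      using c[of b'] by (simp add: power_add algebra_simps)
    finally show "cis t ^ (a + b') = cis t ^ (a' + b)" .
  qed
  with 1 show ?thesis by simp
qed

lemma prod_power_unit_exponent: "k < m \<Longrightarrow> (\<Prod>j<m. f j ^ unit_exponent k j) = f k"
  for f :: "nat \<Rightarrow> 'a::comm_monoid_mult"
proof -
  assume "k < m"
  have "(\<Prod>j<m. f j ^ unit_exponent k j) = (\<Prod>j<m. if j = k then f k else 1)"
    by (intro prod.cong) (auto simp: unit_exponent_def)
  also have "\<dots> = f k" using \<open>k < m\<close> by simp
  finally show ?thesis .
qed

lemma prod_cis: "(\<Prod>k\<in>A. cis (f k)) = cis (\<Sum>k\<in>A. f k)"
  by (induction A rule: infinite_finite_induct) (auto simp: cis_mult)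

lemma rot_mult_neg: "rot \<theta> ** rot (- \<theta>) = mat 1" "rot (- \<theta>) ** rot \<theta> = mat 1"
  by (auto simp: rot_def matrix_matrix_mult_def mat_def vec_eq_iff forall_2
      sum_2 simp flip: power2_eq_square)

section \<open>Monomials in harmonic coordinates\<close>

text \<open>
  The index \<open>(\<gamma>, (\<alpha>, \<beta>))\<close> stands for the monomial \<open>\<lambda>\<^sup>\<gamma> z\<^sup>\<alpha> cnj z\<^sup>\<beta>\<close>; addition of indices is
  multiplication of monomials.
\<close>
type_synonym indices = "(nat \<Rightarrow> nat) \<times> exponents"

locale harmonic_representation =
  fixes \<rho> :: "real^2^2 \<Rightarrow> 'v::real_vector \<Rightarrow> 'v"
    and \<nu>\<^sub>0 r :: nat and n :: "nat \<Rightarrow> nat"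
    and lam :: "nat \<Rightarrow> 'v \<Rightarrow> real" and z :: "nat \<Rightarrow> 'v \<Rightarrow> complex"
  assumes representation: "real_representation SO2 \<rho>"
    and weight_pos: "\<And>k. k < r \<Longrightarrow> 1 \<le> n k"
    and coordinates: "harmonic_coordinates \<rho> \<nu>\<^sub>0 r n lam z"
begin

lemma linear_lam: "i < \<nu>\<^sub>0 \<Longrightarrow> linear (lam i)"
  and lam_rot: "i < \<nu>\<^sub>0 \<Longrightarrow> lam i (\<rho> (rot \<theta>) v) = lam i v"
  and linear_z: "k < r \<Longrightarrow> linear (z k)"
  and z_rot: "k < r \<Longrightarrow> z k (\<rho> (rot \<theta>) v) = exp (\<i> * of_nat (n k) * of_real \<theta>) * z k v"
  using coordinates unfolding harmonic_coordinates_def by blast+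

lemma bij_coordinates:
  "bij_betw (\<lambda>v. (\<lambda>i\<in>{..<\<nu>\<^sub>0}. lam i v, \<lambda>k\<in>{..<r}. z k v)) UNIV
     (({..<\<nu>\<^sub>0} \<rightarrow>\<^sub>E UNIV) \<times> ({..<r} \<rightarrow>\<^sub>E UNIV))"
  using coordinates unfolding harmonic_coordinates_def by blast

lemma obtain_point:
  obtains v where "\<And>i. i < \<nu>\<^sub>0 \<Longrightarrow> lam i v = a i" "\<And>k. k < r \<Longrightarrow> z k v = b k"
proof -
  have "(restrict a {..<\<nu>\<^sub>0}, restrict b {..<r}) \<in>
      range (\<lambda>v. (\<lambda>i\<in>{..<\<nu>\<^sub>0}. lam i v, \<lambda>k\<in>{..<r}. z k v))"
    unfolding bij_betw_imp_surj_on[OF bij_coordinates] by simp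
  then obtain v where "restrict a {..<\<nu>\<^sub>0} = (\<lambda>i\<in>{..<\<nu>\<^sub>0}. lam i v)"
    "restrict b {..<r} = (\<lambda>k\<in>{..<r}. z k v)" by auto
  then show thesis by (intro that[of v]) (metis lessThan_iff restrict_apply')+
qed

lemma point_eqI:
  assumes "\<And>i. i < \<nu>\<^sub>0 \<Longrightarrow> lam i v = lam i w" "\<And>k. k < r \<Longrightarrow> z k v = z k w"
  shows "v = w"
proof -
  have "inj (\<lambda>v. (\<lambda>i\<in>{..<\<nu>\<^sub>0}. lam i v, \<lambda>k\<in>{..<r}. z k v))"
    using bij_coordinates by (rule bij_betw_imp_inj_on)
  then show ?thesis by (rule injD) (use assms in \<open>auto intro!: restrict_ext\<close>)
qed

definition coord_monomial :: "indices \<Rightarrow> 'v \<Rightarrow> complex" where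
  "coord_monomial x v = of_real (\<Prod>i<\<nu>\<^sub>0. lam i v ^ fst x i) * monomial r z (snd x) v"

definition all_indices :: "indices set" where
  "all_indices = {x. (\<forall>i\<ge>\<nu>\<^sub>0. fst x i = 0) \<and> (\<forall>k\<ge>r. fst (snd x) k = 0 \<and> snd (snd x) k = 0)}"

definition invariant_indices :: "indices set" where
  "invariant_indices = {x \<in> all_indices. snd x \<in> solutions r n}"

definition weight :: "indices \<Rightarrow> int" where
  "weight x = (\<Sum>k<r. int (n k) * int (fst (snd x) k)) - (\<Sum>k<r. int (n k) * int (snd (snd x) k))"

lemma invariant_indices_iff_weight:
  "x \<in> all_indices \<Longrightarrow> x \<in> invariant_indices \<longleftrightarrow> weight x = 0"
  by (cases "snd x") (auto simp: invariant_indices_def all_indices_def solutions_def weight_def)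

lemma invariant_indices_subset: "invariant_indices \<subseteq> all_indices"
  by (auto simp: invariant_indices_def)

lemma all_indices_add: "x \<in> all_indices \<Longrightarrow> y \<in> all_indices \<Longrightarrow> x + y \<in> all_indices"
  by (auto simp: all_indices_def)

lemma invariant_indices_add:
  "x \<in> invariant_indices \<Longrightarrow> y \<in> invariant_indices \<Longrightarrow> x + y \<in> invariant_indices"
  by (auto simp: invariant_indices_def all_indices_add solutions_add)

lemma zero_invariant_index: "0 \<in> invariant_indices"
  by (auto simp: invariant_indices_def all_indices_def zero_in_solutions)

lemma coord_monomial_eq:
  "coord_monomial x v = of_real (\<Prod>i<\<nu>\<^sub>0. lam i v ^ fst x i) *
     ((\<Prod>k<r. z k v ^ fst (snd x) k) * (\<Prod>k<r. cnj (z k v) ^ snd (snd x) k))"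
  by (simp add: coord_monomial_def monomial_def case_prod_beta)

lemma coord_monomial_zero [simp]: "coord_monomial 0 v = 1"
  by (simp add: coord_monomial_eq)

lemma coord_monomial_add: "coord_monomial (x + y) v = coord_monomial x v * coord_monomial y v"
  by (simp add: coord_monomial_eq power_add prod.distrib mult_ac)

text \<open>
  Transporting the ring structure of \<open>\<real>\<^sup>\<nu> \<times> \<complex>\<^sup>r\<close> to the representation space turns the monomials
  into multiplicative functions, which is what their linear independence rests on.
\<close>
definition coordinatewise_product :: "'v \<Rightarrow> 'v \<Rightarrow> 'v" where
  "coordinatewise_product v w =
     (SOME u. (\<forall>i<\<nu>\<^sub>0. lam i u = lam i v * lam i w) \<and> (\<forall>k<r. z k u = z k v * z k w))"

lemma coordinatewise_product_coordinates:
  "i < \<nu>\<^sub>0 \<Longrightarrow> lam i (coordinatewise_product v w) = lam i v * lam i w"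
  "k < r \<Longrightarrow> z k (coordinatewise_product v w) = z k v * z k w"
proof -
  have "\<exists>u. (\<forall>i<\<nu>\<^sub>0. lam i u = lam i v * lam i w) \<and> (\<forall>k<r. z k u = z k v * z k w)"
    by (rule obtain_point[of "\<lambda>i. lam i v * lam i w" "\<lambda>k. z k v * z k w"]) blast
  from someI_ex[OF this] show
    "i < \<nu>\<^sub>0 \<Longrightarrow> lam i (coordinatewise_product v w) = lam i v * lam i w"
    "k < r \<Longrightarrow> z k (coordinatewise_product v w) = z k v * z k w"
    unfolding coordinatewise_product_def by blast+
qed

lemma coord_monomial_coordinatewise_product:
  "coord_monomial x (coordinatewise_product v w) = coord_monomial x v * coord_monomial x w"
proof -
  have "coord_monomial x (coordinatewise_product v w)
      = of_real (\<Prod>i<\<nu>\<^sub>0. (lam i v * lam i w) ^ fst x i) *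
     ((\<Prod>k<r. (z k v * z k w) ^ fst (snd x) k) * (\<Prod>k<r. cnj (z k v * z k w) ^ snd (snd x) k))"
    unfolding coord_monomial_eq
    by (intro arg_cong2[of _ _ _ _ "(*)"] arg_cong[of _ _ of_real] prod.cong)
        (simp_all add: coordinatewise_product_coordinates)
  then show ?thesis by (simp add: coord_monomial_eq power_mult_distrib prod.distrib mult_ac)
qed

text \<open>
  Each exponent is recovered by letting one coordinate vary while the others are set to 1.
\<close>
lemma inj_coord_monomial: "inj_on coord_monomial all_indices"
proof (rule inj_onI)
  fix x y assume x: "x \<in> all_indices" and y: "y \<in> all_indices"
    and eq: "coord_monomial x = coord_monomial y"
  have "fst x i = fst y i" for i
  proof (cases "i < \<nu>\<^sub>0")
    case True
    obtain v where v: "\<And>j. j < \<nu>\<^sub>0 \<Longrightarrow> lam j v = (if j = i then 2 else 1)" "\<And>k. k < r \<Longrightarrow> z k v = 1"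
      using obtain_point[of "\<lambda>j. if j = i then 2 else 1" "\<lambda>_. 1"] by blast
    have "(\<Prod>j<\<nu>\<^sub>0. lam j v ^ a j) = (\<Prod>j<\<nu>\<^sub>0. if j = i then 2 ^ a i else 1)" for a
      by (intro prod.cong) (auto simp: v)
    then have "coord_monomial u v = of_real (2 ^ fst u i)" for u
      using True by (simp add: coord_monomial_eq v)
    then have "(2::real) ^ fst x i = 2 ^ fst y i" using eq by (metis of_real_eq_iff)
    then show ?thesis by simp
  qed (use x y in \<open>auto simp: all_indices_def\<close>)
  moreover have "fst (snd x) k = fst (snd y) k \<and> snd (snd x) k = snd (snd y) k" for k
  proof (cases "k < r")
    case True
    show ?thesis
    proof (rule power_cnj_power_eq_imp_eq)
      fix c
      obtain v where v: "\<And>j. j < \<nu>\<^sub>0 \<Longrightarrow> lam j v = 1" "\<And>j. j < r \<Longrightarrow> z j v = (if j = k then c else 1)"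
        using obtain_point[of "\<lambda>_. 1" "\<lambda>j. if j = k then c else 1"] by blast
      have "(\<Prod>j<r. z j v ^ a j) = (\<Prod>j<r. if j = k then c ^ a k else 1)"
        "(\<Prod>j<r. cnj (z j v) ^ a j) = (\<Prod>j<r. if j = k then cnj c ^ a k else 1)" for a
        by (intro prod.cong; auto simp: v)+
      then have "coord_monomial u v = c ^ fst (snd u) k * cnj c ^ snd (snd u) k" for u
        using True by (simp add: coord_monomial_eq v)
      then show "c ^ fst (snd x) k * cnj c ^ snd (snd x) k = c ^ fst (snd y) k * cnj c ^ snd (snd y) k"
        using eq by metis
    qed
  qed (use x y in \<open>auto simp: all_indices_def\<close>)
  ultimately show "x = y" by (simp add: prod_eq_iff fun_eq_iff)
qed

lemma independent_coord_monomial: "cfun.independent (coord_monomial ` all_indices)"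
  unfolding cfun.independent_explicit_module
proof (intro allI impI)
  fix B c \<phi>
  assume B: "finite B" "B \<subseteq> coord_monomial ` all_indices" and \<phi>: "\<phi> \<in> B"
    and eq: "(\<Sum>\<phi>\<in>B. (\<lambda>v. c \<phi> * \<phi> v)) = 0"
  have "\<forall>\<phi>\<in>B. c \<phi> = 0"
  proof (rule distinct_multiplicative_functions_independent[OF B(1), where pr = coordinatewise_product])
    show "\<phi> (coordinatewise_product v w) = \<phi> v * \<phi> w" if "\<phi> \<in> B" for \<phi> v w
      using that B(2) coord_monomial_coordinatewise_product by auto
    show "\<exists>v. \<phi> v \<noteq> 0" if "\<phi> \<in> B" for \<phi>
    proof -
      obtain v where "\<And>j. j < \<nu>\<^sub>0 \<Longrightarrow> lam j v = 1" "\<And>k. k < r \<Longrightarrow> z k v = 1"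
        using obtain_point[of "\<lambda>_. 1" "\<lambda>_. 1"] by blast
      then have "coord_monomial x v = 1" for x by (simp add: coord_monomial_eq)
      then show ?thesis using that B(2) by (metis image_iff subset_iff zero_neq_one)
    qed
    show "(\<Sum>\<phi>\<in>B. c \<phi> * \<phi> v) = 0" for v
      using fun_cong[OF eq, of v] by (simp add: sum_fun_apply)
  qed
  then show "c \<phi> = 0" using \<phi> by blast
qed

section \<open>Coefficients\<close>

definition coeff :: "indices \<Rightarrow> ('v \<Rightarrow> complex) \<Rightarrow> complex" where
  "coeff x f = cfun.representation (coord_monomial ` all_indices) f (coord_monomial x)"

abbreviation polys :: "('v \<Rightarrow> complex) set" where
  "polys \<equiv> cfun.span (coord_monomial ` all_indices)"

abbreviation invariant_polys :: "('v \<Rightarrow> complex) set" where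
  "invariant_polys \<equiv> cfun.span (coord_monomial ` invariant_indices)"

lemma invariant_polys_subset: "invariant_polys \<subseteq> polys"
  by (intro cfun.span_mono image_mono invariant_indices_subset)

lemma coeff_linear:
  assumes "f \<in> polys" "g \<in> polys"
  shows "coeff x (\<lambda>v. c * f v + g v) = c * coeff x f + coeff x g"
proof -
  have "coeff x ((\<lambda>v. c * f v) + g) = c * coeff x f + coeff x g"
    unfolding coeff_def
    using assms by (simp add: cfun.representation_add cfun.representation_scale
        independent_coord_monomial cfun.span_scale)
  then show ?thesis by (simp add: plus_fun_def)
qed

lemma coeff_zero: "coeff x (\<lambda>v. 0) = 0"
  using cfun.representation_zero[of "coord_monomial ` all_indices"]
      by (simp add: coeff_def zero_fun_def)

lemma coeff_coord_monomial:
  "x \<in> all_indices \<Longrightarrow> y \<in> all_indices \<Longrightarrow> coeff x (coord_monomial y) = (if x = y then 1 else 0)"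
  using inj_coord_monomial by (auto simp: coeff_def cfun.representation_basis
      independent_coord_monomial dest: inj_onD)

text \<open>
  Products stay in the span because a product of monomials is again a monomial with index in \<open>X\<close>.
  It is used for the indices of all monomials and for those of the invariant ones.
\<close>
lemma span_coord_monomial_mult:
  assumes X: "\<And>x y. x \<in> X \<Longrightarrow> y \<in> X \<Longrightarrow> x + y \<in> X"
    and f: "f \<in> cfun.span (coord_monomial ` X)" and g: "g \<in> cfun.span (coord_monomial ` X)"
  shows "(\<lambda>v. f v * g v) \<in> cfun.span (coord_monomial ` X)"
  using f
proof (induction rule: span_image_induct)
  case zero
  then show ?case by (simp add: span_zero_fun)
next
  case (step c x f)
  have "(\<lambda>v. coord_monomial x v * g v) \<in> cfun.span (coord_monomial ` X)"
    using g
  proof (induction rule: span_image_induct)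
    case zero
    then show ?case by (simp add: span_zero_fun)
  next
    case (step d y g)
    have "x + y \<in> X" using X \<open>x \<in> X\<close> step(1) .
    then have "(\<lambda>v. d * coord_monomial (x + y) v + coord_monomial x v * g v)
        \<in> cfun.span (coord_monomial ` X)"
      by (intro span_add_fun cfun.span_scale cfun.span_base imageI step)
    then show ?case by (simp add: coord_monomial_add algebra_simps)
  qed
  from span_add_fun[OF cfun.span_scale[OF this, of c] step(3)]
  show ?case by (simp add: algebra_simps)
qed

section \<open>Polynomial functions are combinations of monomials\<close>

lemma coord_monomial_lam: "i < \<nu>\<^sub>0 \<Longrightarrow> coord_monomial (unit_exponent i, 0) = (\<lambda>v. of_real (lam i v))"
  by (rule ext) (simp add: coord_monomial_eq prod_power_unit_exponent)

lemma coord_monomial_z: "k < r \<Longrightarrow> coord_monomial (0, (unit_exponent k, 0)) = (\<lambda>v. z k v)"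
  by (rule ext) (simp add: coord_monomial_eq prod_power_unit_exponent)

lemma coord_monomial_cnj_z: "k < r \<Longrightarrow> coord_monomial (0, (0, unit_exponent k)) = (\<lambda>v. cnj (z k v))"
  by (rule ext) (simp add: coord_monomial_eq prod_power_unit_exponent)

lemma coord_monomial_cmod:
  "k < r \<Longrightarrow> coord_monomial (0, (unit_exponent k, unit_exponent k)) = (\<lambda>v. of_real ((cmod (z k v))\<^sup>2))"
  by (rule ext) (simp add: coord_monomial_eq prod_power_unit_exponent complex_mult_cnj
      cmod_power2 del: of_real_power)

lemma coord_monomial_zero_fst: "coord_monomial (0, s) = monomial r z s"
  by (rule ext) (simp add: coord_monomial_def)

lemma unit_in_all_indices:
  "i < \<nu>\<^sub>0 \<Longrightarrow> (unit_exponent i, 0) \<in> all_indices"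
  "k < r \<Longrightarrow> (0, (unit_exponent k, 0)) \<in> all_indices"
  "k < r \<Longrightarrow> (0, (0, unit_exponent k)) \<in> all_indices"
  by (auto simp: all_indices_def unit_exponent_def)

lemma coordinates_in_polys:
  "i < \<nu>\<^sub>0 \<Longrightarrow> (\<lambda>v. of_real (lam i v)) \<in> polys"
  "k < r \<Longrightarrow> (\<lambda>v. z k v) \<in> polys"
  "k < r \<Longrightarrow> (\<lambda>v. cnj (z k v)) \<in> polys"
proof -
  have "coord_monomial x \<in> polys" if "x \<in> all_indices" for x
    using that by (intro cfun.span_base imageI)
  note * = this[OF unit_in_all_indices(1)] this[OF unit_in_all_indices(2)]
      this[OF unit_in_all_indices(3)]
  show "i < \<nu>\<^sub>0 \<Longrightarrow> (\<lambda>v. of_real (lam i v)) \<in> polys"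
    using *(1) by (simp add: coord_monomial_lam)
  show "k < r \<Longrightarrow> (\<lambda>v. z k v) \<in> polys"
    using *(2) by (simp add: coord_monomial_z)
  show "k < r \<Longrightarrow> (\<lambda>v. cnj (z k v)) \<in> polys"
    using *(3) by (simp add: coord_monomial_cnj_z)
qed

text \<open>
  The coordinates identify the space with \<open>\<real>\<^sup>\<nu> \<times> \<complex>\<^sup>r\<close>, so the preimages of the standard basis
  vectors (with both \<open>1\<close> and \<open>\<i>\<close> in each complex factor) form a basis dual to the coordinates.
\<close>
lemma linear_functional_expansion:
  fixes p :: "'v \<Rightarrow> real"
  assumes "linear p"
  obtains a b c where
    "\<And>v. p v = (\<Sum>i<\<nu>\<^sub>0. lam i v * a i) + (\<Sum>k<r. Re (z k v) * b k + Im (z k v) * c k)"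
proof -
  have "\<forall>i. \<exists>v. (\<forall>j<\<nu>\<^sub>0. lam j v = (if j = i then 1 else 0)) \<and> (\<forall>k<r. z k v = 0)"
    by (rule allI, rule obtain_point[of "\<lambda>j. if j = _ then 1 else 0" "\<lambda>_. 0"]) blast
  then obtain d where d: "\<And>i j. j < \<nu>\<^sub>0 \<Longrightarrow> lam j (d i) = (if j = i then 1 else 0)"
    "\<And>i k. k < r \<Longrightarrow> z k (d i) = 0" by metis
  have "\<forall>i. \<exists>v. (\<forall>j<\<nu>\<^sub>0. lam j v = 0) \<and> (\<forall>k<r. z k v = (if k = i then 1 else 0))"
    by (rule allI, rule obtain_point[of "\<lambda>_. 0" "\<lambda>j. if j = _ then 1 else 0"]) blast
  then obtain e where e: "\<And>i j. j < \<nu>\<^sub>0 \<Longrightarrow> lam j (e i) = 0"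
    "\<And>i k. k < r \<Longrightarrow> z k (e i) = (if k = i then 1 else 0)" by metis
  have "\<forall>i. \<exists>v. (\<forall>j<\<nu>\<^sub>0. lam j v = 0) \<and> (\<forall>k<r. z k v = (if k = i then \<i> else 0))"
    by (rule allI, rule obtain_point[of "\<lambda>_. 0" "\<lambda>j. if j = _ then \<i> else 0"]) blast
  then obtain f where f: "\<And>i j. j < \<nu>\<^sub>0 \<Longrightarrow> lam j (f i) = 0"
    "\<And>i k. k < r \<Longrightarrow> z k (f i) = (if k = i then \<i> else 0)" by metis
  have v: "v = (\<Sum>i<\<nu>\<^sub>0. lam i v *\<^sub>R d i) + (\<Sum>k<r. Re (z k v) *\<^sub>R e k + Im (z k v) *\<^sub>R f k)"
    (is "v = ?w") for v
  proof (rule point_eqI)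
    fix j assume j: "j < \<nu>\<^sub>0"
    note lin = linear_add[OF linear_lam[OF j]] linear_sum[OF linear_lam[OF j]]
        linear_scale[OF linear_lam[OF j]]
    show "lam j v = lam j ?w"
      using j by (simp add: lin d e f if_distrib[of "\<lambda>x. _ * x"] cong: if_cong)
  next
    fix j assume j: "j < r"
    note lin = linear_add[OF linear_z[OF j]] linear_sum[OF linear_z[OF j]]
        linear_scale[OF linear_z[OF j]]
    have "z j ?w = (\<Sum>k<r. if j = k then of_real (Re (z j v)) + of_real (Im (z j v)) * \<i> else 0)"
      using j by (simp add: lin d e f scaleR_conv_of_real if_distrib[of "\<lambda>x. _ * x"] sum.distrib
          cong: if_cong)
    then show "z j v = z j ?w"
      using j complex_eq[of "z j v"] by (simp add: mult.commute)
  qed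
  have "p v = (\<Sum>i<\<nu>\<^sub>0. lam i v * p (d i)) + (\<Sum>k<r. Re (z k v) * p (e k) + Im (z k v) * p (f k))" for v
    by (subst v) (simp add: linear_add[OF assms] linear_sum[OF assms] linear_scale[OF assms])
  then show thesis by (rule that)
qed

text \<open>
  Linear functionals lie in the span since \<open>Re z\<close> and \<open>Im z\<close> are combinations of \<open>z\<close> and \<open>cnj z\<close>;
  the span is closed under sums and products.
\<close>
lemma polynomial_function_in_polys:
  assumes "p \<in> polynomial_functions"
  shows "(\<lambda>v. of_real (p v)) \<in> polys"
  using assms unfolding polynomial_functions_def
proof induction
  case (gen p)
  then have "linear p" by simp
  then obtain a b c where p:
    "\<And>v. p v = (\<Sum>i<\<nu>\<^sub>0. lam i v * a i) + (\<Sum>k<r. Re (z k v) * b k + Im (z k v) * c k)"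
    by (rule linear_functional_expansion) blast
  have pt: "of_real (Re w * s + Im w * t) = Complex (s/2) (- t/2) * w
      + Complex (s/2) (t/2) * cnj w" for w s t
    by (simp add: complex_eq_iff algebra_simps)
  have *: "of_real (p v) = (\<Sum>i<\<nu>\<^sub>0. of_real (a i) * of_real (lam i v)) +
      (\<Sum>k<r. Complex (b k / 2) (- c k / 2) * z k v + Complex (b k / 2) (c k / 2) * cnj (z k v))" for v
    unfolding pt [symmetric] p by (simp add: mult.commute)
  show ?case unfolding *
    by (intro span_add_fun span_sum_fun cfun.span_scale coordinates_in_polys) auto
next
  case (const c)
  have "(\<lambda>v. of_real c * coord_monomial 0 v) \<in> polys"
    by (intro cfun.span_scale cfun.span_base imageI)
      (use zero_invariant_index invariant_indices_subset in blast)
  then show ?case by simp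
next
  case (add f g)
  then show ?case using span_add_fun by simp
next
  case (mult f g)
  then show ?case using span_coord_monomial_mult[OF all_indices_add] by simp
qed

section \<open>Invariants are combinations of monomials of weight zero\<close>

lemma coord_monomial_rot:
  "coord_monomial x (\<rho> (rot \<theta>) v) = cis (\<theta> * of_int (weight x)) * coord_monomial x v"
proof -
  define c where "c = (\<lambda>k. cis (\<theta> * real (n k)))"
  have z: "z k (\<rho> (rot \<theta>) v) = c k * z k v" if "k < r" for k
    using z_rot[OF that, of \<theta> v] by (simp add: c_def cis_conv_exp mult_ac)
  have c: "(\<Prod>k<r. c k ^ a k) = cis (\<theta> * (\<Sum>k<r. real (n k) * real (a k)))" for a
    by (simp add: c_def Complex.DeMoivre prod_cis sum_distrib_left mult_ac)
  have "coord_monomial x (\<rho> (rot \<theta>) v) = of_real (\<Prod>i<\<nu>\<^sub>0. lam i v ^ fst x i) *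
     ((\<Prod>k<r. (c k * z k v) ^ fst (snd x) k) * (\<Prod>k<r. cnj (c k * z k v) ^ snd (snd x) k))"
    unfolding coord_monomial_eq
    by (intro arg_cong2[of _ _ _ _ "(*)"] arg_cong[of _ _ of_real] prod.cong) (simp_all add: z lam_rot)
  also have "\<dots> = (\<Prod>k<r. c k ^ fst (snd x) k) * cnj (\<Prod>k<r. c k ^ snd (snd x) k) * coord_monomial x v"
    by (simp add: coord_monomial_eq power_mult_distrib prod.distrib mult_ac)
  also have "(\<Prod>k<r. c k ^ fst (snd x) k) * cnj (\<Prod>k<r. c k ^ snd (snd x) k)
      = cis (\<theta> * of_int (weight x))"
    unfolding c by (simp add: cis_cnj cis_mult weight_def algebra_simps)
  finally show ?thesis .
qed

lemma coeff_rot: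
  assumes "f \<in> polys" "x \<in> all_indices"
  shows "coeff x (\<lambda>v. f (\<rho> (rot \<theta>) v)) = cis (\<theta> * of_int (weight x)) * coeff x f"
proof -
  have "(\<lambda>v. f (\<rho> (rot \<theta>) v)) \<in> polys \<and> ?thesis"
    using assms(1)
  proof (induction rule: span_image_induct)
    case zero
    then show ?case by (simp add: coeff_zero span_zero_fun)
  next
    case (step c y g)
    define d where "d = c * cis (\<theta> * of_int (weight y))"
    have y: "coord_monomial y \<in> polys" using step(1) by (intro cfun.span_base imageI)
    have "(\<lambda>v. c * coord_monomial y (\<rho> (rot \<theta>) v) + g (\<rho> (rot \<theta>) v))
        = (\<lambda>v. d * coord_monomial y v + g (\<rho> (rot \<theta>) v))"
      by (simp add: coord_monomial_rot d_def mult_ac)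
    moreover have "d * coeff x (coord_monomial y)
        = cis (\<theta> * of_int (weight x)) * (c * coeff x (coord_monomial y))"
      using coeff_coord_monomial[OF assms(2) step(1)] by (auto simp: d_def)
    moreover have "coeff x (\<lambda>v. d * coord_monomial y v + g (\<rho> (rot \<theta>) v))
        = d * coeff x (coord_monomial y) + coeff x (\<lambda>v. g (\<rho> (rot \<theta>) v))"
      using step(3) by (intro coeff_linear y) auto
    moreover have "(\<lambda>v. d * coord_monomial y v + g (\<rho> (rot \<theta>) v)) \<in> polys"
      using step(3) by (intro span_add_fun cfun.span_scale y) auto
    ultimately show ?case
      using step(3) coeff_linear[OF y step(2), of x c] by (simp only: distrib_left)
  qed
  then show ?thesis ..
qed

text \<open>
  A rotation multiplies the coefficient at an index \<open>x\<close> by \<open>cis (\<theta> * weight x)\<close>. If the weight is not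
  zero, some rotation changes its sign, so the coefficient of an invariant vanishes.
\<close>
lemma rotation_invariant_in_invariant_polys:
  assumes f: "f \<in> polys" and inv: "\<And>\<theta> v. f (\<rho> (rot \<theta>) v) = f v"
  shows "f \<in> invariant_polys"
proof -
  have x: "x \<in> invariant_indices" if "x \<in> all_indices" "coeff x f \<noteq> 0" for x
  proof (rule ccontr)
    assume "\<not> ?thesis"
    then have w: "weight x \<noteq> 0" using invariant_indices_iff_weight that by blast
    \<comment> \<open>The rotation by \<open>pi / weight x\<close> multiplies the coefficient by \<open>cis pi = - 1\<close>.\<close>
    have "coeff x f = cis (pi / of_int (weight x) * of_int (weight x)) * coeff x f"
      using coeff_rot[OF f that(1), of "pi / of_int (weight x)"] inv by simp
    then have "coeff x f = - coeff x f" using w by simp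
    then have "2 * coeff x f = 0" by (metis add.right_inverse mult_2)
    with that(2) show False by simp
  qed
  let ?rep = "cfun.representation (coord_monomial ` all_indices) f"
  have "(\<Sum>b | ?rep b \<noteq> 0. (\<lambda>v. ?rep b * b v)) \<in> invariant_polys"
  proof (intro cfun.span_sum cfun.span_scale cfun.span_base)
    fix b assume b: "b \<in> {b. ?rep b \<noteq> 0}"
    then obtain y where "y \<in> all_indices" "b = coord_monomial y"
      using cfun.representation_ne_zero by blast
    then show "b \<in> coord_monomial ` invariant_indices" using b x[of y] by (simp add: coeff_def)
  qed
  then show ?thesis
    by (simp only: cfun.sum_nonzero_representation_eq[OF independent_coord_monomial f])
qed

lemma Inv_iff:
  "p \<in> Inv SO2 \<rho> \<longleftrightarrow> p \<in> polynomial_functions \<and> (\<forall>\<theta> v. p (\<rho> (rot \<theta>) v) = p v)"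
proof -
  have "rot \<theta> \<in> SO2" for \<theta> by (simp add: SO2_eq_range_rot)
  then have "\<rho> (rot \<theta>) \<circ> \<rho> (rot (- \<theta>)) = id" "\<rho> (rot (- \<theta>)) \<circ> \<rho> (rot \<theta>) = id" for \<theta>
    using representation rot_mult_neg[of \<theta>] unfolding real_representation_def by metis+
  then have inv: "inv (\<rho> (rot \<theta>)) = \<rho> (rot (- \<theta>))" for \<theta>
    by (rule inv_unique_comp)
  have "(\<forall>g\<in>SO2. act \<rho> g p = p) \<longleftrightarrow> (\<forall>\<theta> v. p (\<rho> (rot (- \<theta>)) v) = p v)"
    by (simp add: SO2_eq_range_rot act_def inv fun_eq_iff)
  also have "\<dots> \<longleftrightarrow> (\<forall>\<theta> v. p (\<rho> (rot \<theta>) v) = p v)"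
    by (metis minus_minus)
  finally show ?thesis by (simp add: Inv_def)
qed

lemma Inv_in_invariant_polys: "p \<in> Inv SO2 \<rho> \<Longrightarrow> (\<lambda>v. of_real (p v)) \<in> invariant_polys"
  by (intro rotation_invariant_in_invariant_polys polynomial_function_in_polys) (auto simp: Inv_iff)

lemma algebra_gen_subset_Inv: "S \<subseteq> Inv SO2 \<rho> \<Longrightarrow> algebra_gen S \<subseteq> Inv SO2 \<rho>"
proof
  fix p assume S: "S \<subseteq> Inv SO2 \<rho>" and "p \<in> algebra_gen S"
  from this(2) show "p \<in> Inv SO2 \<rho>"
  proof induction
    case (gen f)
    then show ?case using S by blast
  qed (auto simp: Inv_iff polynomial_functions_def intro: algebra_gen.intros)
qed

lemma coord_monomial_invariant:
  "x \<in> invariant_indices \<Longrightarrow> coord_monomial x (\<rho> (rot \<theta>) v) = coord_monomial x v"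
  using invariant_indices_iff_weight[of x] invariant_indices_subset by (auto simp: coord_monomial_rot)

lemma coord_monomial_polynomial: "coord_monomial x \<in> complexified_gen {f. linear f}"
proof -
  have "lam i \<in> algebra_gen {f. linear f}" if "i < \<nu>\<^sub>0" for i
    using linear_lam[OF that] by (auto intro: algebra_gen.gen)
  then have l: "(\<lambda>v. of_real (lam i v)) \<in> complexified_gen {f. linear f}" if "i < \<nu>\<^sub>0" for i
    using that by (intro complexified_gen_of_real)
  have z: "z k \<in> complexified_gen {f. linear f}" if "k < r" for k
    using linear_compose[OF linear_z[OF that] bounded_linear.linear[OF bounded_linear_Re]]
      linear_compose[OF linear_z[OF that] bounded_linear.linear[OF bounded_linear_Im]]
    by (auto simp: complexified_gen_def o_def intro: algebra_gen.gen)
  have "(\<lambda>v. (\<Prod>i<\<nu>\<^sub>0. of_real (lam i v) ^ fst x i) *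
     ((\<Prod>k<r. z k v ^ fst (snd x) k) * (\<Prod>k<r. cnj (z k v) ^ snd (snd x) k)))
         \<in> complexified_gen {f. linear f}"
    by (intro complexified_gen_mult complexified_gen_prod_power l z complexified_gen_cnj)
  then show ?thesis by (simp add: coord_monomial_eq[abs_def])
qed

lemma Re_Im_coord_monomial_in_Inv:
  assumes "x \<in> invariant_indices"
  shows "(\<lambda>v. Re (coord_monomial x v)) \<in> Inv SO2 \<rho>" "(\<lambda>v. Im (coord_monomial x v)) \<in> Inv SO2 \<rho>"
  using coord_monomial_polynomial[of x] coord_monomial_invariant[OF assms]
  by (auto simp: Inv_iff polynomial_functions_def complexified_gen_def)

section \<open>Generation of the algebra of invariants\<close>

definition generators :: "exponents set \<Rightarrow> ('v \<Rightarrow> real) set" where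
  "generators M = {lam i | i. i < \<nu>\<^sub>0}
      \<union> {\<lambda>v. (cmod (z k v))\<^sup>2 | k. k < r}
      \<union> {\<lambda>v. Re (monomial r z m v) | m. m \<in> M}
      \<union> {\<lambda>v. Im (monomial r z m v) | m. m \<in> M}"

lemma generators_cases [consumes 1, case_names lam cmod Re Im]:
  assumes "p \<in> generators M"
    and "\<And>i. i < \<nu>\<^sub>0 \<Longrightarrow> p = lam i \<Longrightarrow> P"
    and "\<And>k. k < r \<Longrightarrow> p = (\<lambda>v. (cmod (z k v))\<^sup>2) \<Longrightarrow> P"
    and "\<And>m. m \<in> M \<Longrightarrow> p = (\<lambda>v. Re (monomial r z m v)) \<Longrightarrow> P"
    and "\<And>m. m \<in> M \<Longrightarrow> p = (\<lambda>v. Im (monomial r z m v)) \<Longrightarrow> P"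
  shows P
  using assms(1) unfolding generators_def
  by (elim UnE CollectE exE conjE) ((rule assms(2-5); assumption)+)

lemma unit_in_invariant_indices:
  "i < \<nu>\<^sub>0 \<Longrightarrow> (unit_exponent i, 0) \<in> invariant_indices"
  by (auto simp: invariant_indices_def all_indices_def unit_exponent_def zero_in_solutions)

lemma solution_in_invariant_indices: "s \<in> solutions r n \<Longrightarrow> (0, s) \<in> invariant_indices"
  by (auto simp: invariant_indices_def all_indices_def solutions_iff)

lemma unit_pair_solution: "k < r \<Longrightarrow> (unit_exponent k, unit_exponent k) \<in> solutions r n"
  using unit_pair_irreducible[of k r n] weight_pos[of k] by (simp add: irreducible_solutions_def)

lemma irreducible_solutionD: "s \<in> irreducible_solutions r n \<Longrightarrow> s \<in> solutions r n"
  by (simp add: irreducible_solutions_def)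

lemma generators_subset_Inv:
  assumes M: "M \<subseteq> solutions r n"
  shows "generators M \<subseteq> Inv SO2 \<rho>"
proof
  fix p assume "p \<in> generators M"
  then show "p \<in> Inv SO2 \<rho>"
  proof (cases rule: generators_cases)
    case (lam i)
    then show ?thesis using Re_Im_coord_monomial_in_Inv(1)[OF unit_in_invariant_indices[of i]]
      by (simp add: coord_monomial_lam)
  next
    case (cmod k)
    then show ?thesis
      using Re_Im_coord_monomial_in_Inv(1)[OF solution_in_invariant_indices[OF
          unit_pair_solution[of k]]]
      by (simp add: coord_monomial_cmod del: of_real_power)
  next
    case (Re m)
    then show ?thesis
      using Re_Im_coord_monomial_in_Inv(1)[OF solution_in_invariant_indices[of m]] M
      by (auto simp: coord_monomial_zero_fst)
  next
    case (Im m)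
    then show ?thesis
      using Re_Im_coord_monomial_in_Inv(2)[OF solution_in_invariant_indices[of m]] M
      by (auto simp: coord_monomial_zero_fst)
  qed
qed

lemma monomial_add: "monomial r z (s + t) v = monomial r z s v * monomial r z t v"
  using coord_monomial_add[of "(0, s)" "(0, t)" v] by (simp add: coord_monomial_zero_fst)

text \<open>
  By factorization only irreducible solutions matter: self-conjugate ones give \<open>\<bar>z\<^sub>k\<bar>\<^sup>2\<close>, and for the
  others the monomial or its conjugate belongs to a chosen representative.
\<close>
lemma monomial_in_complexified_gen:
  assumes M: "\<And>s. s \<in> irreducible_solutions r n \<Longrightarrow> s \<noteq> conj_exponents s \<Longrightarrow> s \<in> M \<or> conj_exponents s \<in> M"
    and s: "s \<in> solutions r n"
  shows "monomial r z s \<in> complexified_gen (generators M)"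
  using s
proof (induction rule: solutions_factorize)
  case zero
  have "monomial r z 0 = (\<lambda>v. 1)" by (rule ext) (simp add: monomial_def zero_prod_def)
  then show ?case by (simp add: complexified_gen_const)
next
  case (irreducible s)
  have gen: "monomial r z m \<in> complexified_gen (generators M)" if "m \<in> M" for m
  proof -
    have "(\<lambda>v. Re (monomial r z m v)) \<in> generators M" "(\<lambda>v. Im (monomial r z m v)) \<in> generators M"
      using that unfolding generators_def by blast+
    then show ?thesis by (simp add: complexified_gen_def algebra_gen.gen)
  qed
  consider "s = conj_exponents s" | "s \<in> M" | "conj_exponents s \<in> M" using M[OF irreducible] by blast
  then show ?case
  proof cases
    case 1
    with irreducible obtain k where k: "k < r" "s = (unit_exponent k, unit_exponent k)"
      using self_conjugate_irreducible by blast
    have "(\<lambda>v. (cmod (z k v))\<^sup>2) \<in> algebra_gen (generators M)"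
      using k by (intro algebra_gen.gen) (auto simp: generators_def)
    from complexified_gen_of_real[OF this] show ?thesis
      using coord_monomial_cmod[OF k(1)] by (simp add: k(2) coord_monomial_zero_fst)
  next
    case 2
    then show ?thesis by (rule gen)
  next
    case 3
    from complexified_gen_cnj[OF gen[OF this]] show ?thesis
      by (simp add: monomial_conj_exponents)
  qed
next
  case (sum s t)
  from complexified_gen_mult[OF this] show ?case by (simp flip: monomial_add)
qed

text \<open>
  An invariant \<open>p\<close> is a complex combination of products of generators; taking real parts turns it
  into a real polynomial in them.
\<close>
lemma Inv_subset_algebra_gen:
  assumes M: "\<And>s. s \<in> irreducible_solutions r n \<Longrightarrow> s \<noteq> conj_exponents s \<Longrightarrow> s \<in> M \<or> conj_exponents s \<in> M"
  shows "Inv SO2 \<rho> \<subseteq> algebra_gen (generators M)"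
proof
  have coord_monomial: "coord_monomial x \<in> complexified_gen (generators M)"
    if "x \<in> invariant_indices" for x
  proof -
    have "(\<lambda>v. of_real (lam i v)) \<in> complexified_gen (generators M)" if "i < \<nu>\<^sub>0" for i
      using that by (intro complexified_gen_of_real algebra_gen.gen) (auto simp: generators_def)
    moreover have "monomial r z (snd x) \<in> complexified_gen (generators M)"
      using M that by (intro monomial_in_complexified_gen) (auto simp: invariant_indices_def)
    ultimately have "(\<lambda>v. (\<Prod>i<\<nu>\<^sub>0. of_real (lam i v) ^ fst x i) * monomial r z (snd x) v)
        \<in> complexified_gen (generators M)"
      by (intro complexified_gen_mult complexified_gen_prod_power)
    then show ?thesis by (simp add: coord_monomial_def[abs_def])
  qed
  fix p assume "p \<in> Inv SO2 \<rho>"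
  from Inv_in_invariant_polys[OF this] have "(\<lambda>v. of_real (p v)) \<in> complexified_gen (generators M)"
  proof (induction rule: span_image_induct)
    case zero
    show ?case by (rule complexified_gen_const)
  next
    case (step c x g)
    then show ?case by (intro complexified_gen_add complexified_gen_mult complexified_gen_const
        coord_monomial)
  qed
  then show "p \<in> algebra_gen (generators M)" by (simp add: complexified_gen_def)
qed

lemma homogeneous_monomial:
  "homogeneous (\<lambda>v. Re (monomial r z s v))" "homogeneous (\<lambda>v. Im (monomial r z s v))"
proof -
  define d where "d = (\<Sum>k<r. fst s k) + (\<Sum>k<r. snd s k)"
  have z: "z k (t *\<^sub>R v) = of_real t * z k v" if "k < r" for k t v
    using linear_scale[OF linear_z[OF that]] by (simp add: scaleR_conv_of_real)
  have "monomial r z s (t *\<^sub>R v) =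
      (\<Prod>k<r. (of_real t * z k v) ^ fst s k) * (\<Prod>k<r. cnj (of_real t * z k v) ^ snd s k)" for t v
    unfolding monomial_def case_prod_beta
    by (intro arg_cong2[of _ _ _ _ "(*)"] prod.cong) (simp_all add: z)
  then have "monomial r z s (t *\<^sub>R v) = of_real (t ^ d) * monomial r z s v" for t v
    by (simp add: monomial_def case_prod_beta d_def power_mult_distrib prod.distrib power_add
        power_sum mult_ac)
  then show "homogeneous (\<lambda>v. Re (monomial r z s v))" "homogeneous (\<lambda>v. Im (monomial r z s v))"
    unfolding homogeneous_def by (auto intro!: exI[of _ d] simp del: of_real_power)
qed

lemma homogeneous_generators:
  assumes "p \<in> generators M" shows "homogeneous p"
  using assms
proof (cases rule: generators_cases)
  case (lam i)
  then show ?thesis unfolding homogeneous_def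
    using linear_scale[OF linear_lam] by (auto intro!: exI[of _ 1])
next
  case (cmod k)
  then have "p = (\<lambda>v. Re (monomial r z (unit_exponent k, unit_exponent k) v))"
    using coord_monomial_cmod[of k] by (simp add: coord_monomial_zero_fst)
  then show ?thesis using homogeneous_monomial by simp
qed (use homogeneous_monomial in auto)

lemma finite_generators:
  assumes "finite M" shows "finite (generators M)"
  using assms unfolding generators_def setcompr_eq_image by simp

section \<open>Minimality\<close>

text \<open>
  Irreducibility extended to indices, so that the coordinates \<open>lam i\<close> are treated on the same footing
  as the irreducible monomials.
\<close>
definition indecomposable :: "indices \<Rightarrow> bool" where
  "indecomposable m \<longleftrightarrow> m \<in> invariant_indices \<and> m \<noteq> 0 \<and>
     (\<forall>x\<in>invariant_indices. \<forall>y\<in>invariant_indices. m = x + y \<longrightarrow> x = 0 \<or> y = 0)"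

lemma indecomposable_unit:
  assumes "i < \<nu>\<^sub>0" shows "indecomposable (unit_exponent i, 0)"
proof -
  have "x = 0 \<or> y = 0" if "(unit_exponent i, 0) = x + y" for x y :: indices
  proof -
    have e: "fst x j + fst y j = unit_exponent i j" "fst (snd x) j + fst (snd y) j = 0"
      "snd (snd x) j + snd (snd y) j = 0" for j
      using arg_cong[OF that, of "\<lambda>u. fst u j"] arg_cong[OF that, of "\<lambda>u. fst (snd u) j"]
        arg_cong[OF that, of "\<lambda>u. snd (snd u) j"] by simp_all
    have 0: "fst x j = 0 \<and> fst y j = 0" if "j \<noteq> i" for j
      using e(1)[of j] that by (simp add: unit_exponent_def)
    have "fst x i = 0 \<or> fst y i = 0" using e(1)[of i] by (auto simp: unit_exponent_def)
    then have "(\<forall>j. fst x j = 0) \<or> (\<forall>j. fst y j = 0)" using 0 by metis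
    then show ?thesis using e(2,3) by (auto simp: prod_eq_iff fun_eq_iff)
  qed
  moreover have "(unit_exponent i, 0) \<noteq> (0 :: indices)"
    by (auto simp: prod_eq_iff fun_eq_iff unit_exponent_def)
  ultimately show ?thesis
    using unit_in_invariant_indices[OF assms] unfolding indecomposable_def by blast
qed

lemma indecomposable_irreducible:
  assumes s: "s \<in> irreducible_solutions r n" shows "indecomposable (0, s)"
proof -
  have "x = 0 \<or> y = 0" if "(0, s) = x + y" "x \<in> invariant_indices" "y \<in> invariant_indices" for x y
  proof -
    have "fst x j + fst y j = 0" for j using arg_cong[OF that(1), of "\<lambda>u. fst u j"] by simp
    then have "fst x = 0" "fst y = 0" by (auto simp: fun_eq_iff)
    moreover have "s = snd x + snd y" using arg_cong[OF that(1), of snd] by simp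
    then have "snd x = 0 \<or> snd y = 0"
      using s that(2,3) unfolding irreducible_solutions_def invariant_indices_def by blast
    ultimately show ?thesis by (auto simp: prod_eq_iff)
  qed
  moreover have "(0, s) \<noteq> 0" using s by (auto simp: irreducible_solutions_def prod_eq_iff)
  ultimately show ?thesis
    using solution_in_invariant_indices[OF irreducible_solutionD[OF s]]
    unfolding indecomposable_def by blast
qed

lemma coord_monomial_at_zero:
  assumes "x \<in> all_indices" shows "coord_monomial x 0 = (if x = 0 then 1 else 0)"
proof (cases "x = 0")
  case False
  then have "(\<exists>i<\<nu>\<^sub>0. fst x i \<noteq> 0) \<or> (\<exists>k<r. fst (snd x) k \<noteq> 0) \<or> (\<exists>k<r. snd (snd x) k \<noteq> 0)"
    using assms unfolding all_indices_def mem_Collect_eq prod_eq_iff fun_eq_iff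
    by (metis fst_zero not_le snd_zero zero_fun_apply)
  moreover have "lam i 0 = 0" if "i < \<nu>\<^sub>0" for i using linear_0[OF linear_lam[OF that]] .
  moreover have "z k 0 = 0" if "k < r" for k using linear_0[OF linear_z[OF that]] .
  ultimately have "coord_monomial x 0 = 0" unfolding coord_monomial_eq by (auto simp: prod_zero_iff)
  with False show ?thesis by simp
qed simp

lemma coord_monomial_in_polys: "x \<in> all_indices \<Longrightarrow> coord_monomial x \<in> polys"
  by (intro cfun.span_base imageI)

text \<open>
  Both sides are bilinear, so it suffices to compare them on monomials \<open>x\<close> and \<open>y\<close>. There it says
  that \<open>m = x + y\<close> only for \<open>x = 0, y = m\<close> or \<open>x = m, y = 0\<close>, as the value of a monomial at the
  origin is 1 for index 0 and 0 otherwise.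
\<close>
lemma coeff_mult:
  assumes m: "indecomposable m" and f: "f \<in> invariant_polys" and g: "g \<in> invariant_polys"
  shows "coeff m (\<lambda>v. f v * g v) = f 0 * coeff m g + coeff m f * g 0"
proof -
  note all = subsetD[OF invariant_indices_subset] and pol = subsetD[OF invariant_polys_subset]
    and mult = span_coord_monomial_mult[OF invariant_indices_add]
  have mi: "m \<in> all_indices" using m all by (auto simp: indecomposable_def)
  have base: "coeff m (\<lambda>v. coord_monomial x v * g v)
      = coord_monomial x 0 * coeff m g + coeff m (coord_monomial x) * g 0"
    if x: "x \<in> invariant_indices" for x
    using g
  proof (induction rule: span_image_induct)
    case zero
    then show ?case by (simp add: coeff_zero)
  next
    case (step c y g)
    have xg: "(\<lambda>v. coord_monomial x v * g v) \<in> invariant_polys"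
      using x by (intro mult step cfun.span_base imageI)
    have xy: "x + y \<in> all_indices" using x step(1) all invariant_indices_add by blast
    have eq: "coeff m (coord_monomial (x + y))
        = coord_monomial x 0 * coeff m (coord_monomial y)
            + coeff m (coord_monomial x) * coord_monomial y 0"
      using m x step(1) all xy mi
      by (auto simp: coeff_coord_monomial coord_monomial_at_zero indecomposable_def)
    have "coeff m (\<lambda>v. coord_monomial x v * (c * coord_monomial y v + g v))
        = coeff m (\<lambda>v. c * coord_monomial (x + y) v + coord_monomial x v * g v)"
      by (simp add: coord_monomial_add algebra_simps)
    also have "\<dots> = c * coeff m (coord_monomial (x + y)) + coeff m (\<lambda>v. coord_monomial x v * g v)"
      by (intro coeff_linear coord_monomial_in_polys xy pol xg)
    also have "\<dots> = coord_monomial x 0 * (c * coeff m (coord_monomial y) + coeff m g)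
        + coeff m (coord_monomial x) * (c * coord_monomial y 0 + g 0)"
      unfolding eq step(3) by (simp add: algebra_simps)
    also have "c * coeff m (coord_monomial y) + coeff m g = coeff m (\<lambda>v. c * coord_monomial y v + g v)"
      by (intro coeff_linear[symmetric] coord_monomial_in_polys all pol step)
    finally show ?case .
  qed
  show ?thesis using f
  proof (induction rule: span_image_induct)
    case zero
    then show ?case by (simp add: coeff_zero)
  next
    case (step c x f)
    have "coeff m (\<lambda>v. (c * coord_monomial x v + f v) * g v)
        = coeff m (\<lambda>v. c * (coord_monomial x v * g v) + f v * g v)"
      by (simp add: algebra_simps)
    also have "\<dots> = c * coeff m (\<lambda>v. coord_monomial x v * g v) + coeff m (\<lambda>v. f v * g v)"
      by (intro coeff_linear pol mult g step(2) cfun.span_base[OF imageI[OF step(1)]])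
    also have "\<dots> = (c * coord_monomial x 0 + f 0) * coeff m g
        + (c * coeff m (coord_monomial x) + coeff m f) * g 0"
      unfolding base[OF step(1)] step(3) by (simp add: algebra_simps)
    also have "c * coeff m (coord_monomial x) + coeff m f = coeff m (\<lambda>v. c * coord_monomial x v + f v)"
      by (intro coeff_linear[symmetric] coord_monomial_in_polys all pol step)
    finally show ?case .
  qed
qed

text \<open>
  The factor \<open>\<omega>\<close> selects the real part (\<open>\<omega> = 1\<close>) or, up to sign, the imaginary part (\<open>\<omega> = \<i>\<close>) of the
  coefficient, which is what tells \<open>Re m\<close> from \<open>Im m\<close>.
\<close>
definition real_coeff :: "complex \<Rightarrow> indices \<Rightarrow> ('v \<Rightarrow> real) \<Rightarrow> real" where
  "real_coeff \<omega> m p = Re (\<omega> * coeff m (\<lambda>v. of_real (p v)))"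

text \<open>
  By \<open>coeff_mult\<close> the functional is a derivation at the origin. Real-valued functions take real values
  there, so the derivation rule survives taking the real part.
\<close>
lemma real_coeff_algebra_gen:
  assumes m: "indecomposable m" and T: "T \<subseteq> Inv SO2 \<rho>" "\<And>p. p \<in> T \<Longrightarrow> real_coeff \<omega> m p = 0"
    and p: "p \<in> algebra_gen T"
  shows "real_coeff \<omega> m p = 0"
  using p
proof induction
  case (gen p)
  then show ?case by (rule T(2))
next
  case (const c)
  have 0: "0 \<in> all_indices" and m': "m \<in> all_indices" "m \<noteq> 0"
    using m zero_invariant_index invariant_indices_subset by (auto simp: indecomposable_def)
  have "coeff m (\<lambda>v. of_real c * coord_monomial 0 v + 0) = 0"
    using coeff_linear[OF coord_monomial_in_polys[OF 0] span_zero_fun, of m "of_real c"] m'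
    by (simp only: coeff_coord_monomial[OF m'(1) 0] coeff_zero) simp
  then show ?case by (simp add: real_coeff_def)
next
  case (add f g)
  then have "(\<lambda>v. of_real (f v)) \<in> polys" "(\<lambda>v. of_real (g v)) \<in> polys"
    using algebra_gen_subset_Inv[OF T(1)] by (auto intro!: polynomial_function_in_polys simp: Inv_iff)
  from coeff_linear[OF this, of m 1] show ?case
    using add.IH by (simp add: real_coeff_def distrib_left)
next
  case (mult f g)
  then have "(\<lambda>v. of_real (f v)) \<in> invariant_polys" "(\<lambda>v. of_real (g v)) \<in> invariant_polys"
    using algebra_gen_subset_Inv[OF T(1)] by (auto intro!: Inv_in_invariant_polys)
  from coeff_mult[OF m this]
  have "real_coeff \<omega> m (\<lambda>v. f v * g v) = Re (of_real (f 0) * (\<omega> * coeff m (\<lambda>v. of_real (g v)))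
      + of_real (g 0) * (\<omega> * coeff m (\<lambda>v. of_real (f v))))"
    by (simp add: real_coeff_def algebra_simps)
  then show ?case
    using mult.IH by (simp add: real_coeff_def)
qed

lemma real_coeff_lam:
  "i < \<nu>\<^sub>0 \<Longrightarrow> m \<in> all_indices \<Longrightarrow> real_coeff \<omega> m (lam i) = (if m = (unit_exponent i, 0) then Re \<omega> else 0)"
  using coeff_coord_monomial[OF _ unit_in_all_indices(1), of m i]
      by (simp add: real_coeff_def coord_monomial_lam)

lemma real_coeff_cmod:
  assumes k: "k < r" and m: "m \<in> all_indices"
  shows "real_coeff \<omega> m (\<lambda>v. (cmod (z k v))\<^sup>2) =
      (if m = (0, (unit_exponent k, unit_exponent k)) then Re \<omega> else 0)"
proof -
  have "(0, (unit_exponent k, unit_exponent k)) \<in> all_indices"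
    using k by (auto simp: all_indices_def unit_exponent_def)
  from coeff_coord_monomial[OF m this] show ?thesis
    by (simp add: real_coeff_def coord_monomial_cmod[OF k] del: of_real_power)
qed

text \<open>
  Read off from \<open>Re m = (m + cnj m) / 2\<close> and \<open>Im m = (m - cnj m) / (2 \<i>)\<close>.
\<close>
lemma real_coeff_monomial:
  assumes s: "s \<in> solutions r n" and m: "m \<in> all_indices"
  shows "real_coeff \<omega> m (\<lambda>v. Re (monomial r z s v)) =
      (if m = (0, s) then Re \<omega> / 2 else 0)
      + (if m = (0, conj_exponents s) then Re \<omega> / 2 else 0)" (is ?Re)
    and "real_coeff \<omega> m (\<lambda>v. Im (monomial r z s v)) =
      (if m = (0, s) then Im \<omega> / 2 else 0)
      - (if m = (0, conj_exponents s) then Im \<omega> / 2 else 0)" (is ?Im)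
proof -
  note all = subsetD[OF invariant_indices_subset]
  have i: "(0, s) \<in> all_indices" "(0, conj_exponents s) \<in> all_indices"
    using all solution_in_invariant_indices solutions_conj s by blast+
  have pair: "coeff m (\<lambda>v. c * coord_monomial (0, s) v + d * coord_monomial (0, conj_exponents s) v) =
      (if m = (0, s) then c else 0) + (if m = (0, conj_exponents s) then d else 0)" for c d
  proof -
    have d: "(\<lambda>v. d * coord_monomial (0, conj_exponents s) v) \<in> polys"
      by (intro cfun.span_scale coord_monomial_in_polys i)
    have "coeff m (\<lambda>v. d * coord_monomial (0, conj_exponents s) v + 0)
        = d * coeff m (coord_monomial (0, conj_exponents s)) + 0"
      using coeff_linear[OF coord_monomial_in_polys[OF i(2)] span_zero_fun, of m d]
          by (simp only: coeff_zero)
    then show ?thesis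
      using coeff_linear[OF coord_monomial_in_polys[OF i(1)] d, of m c]
      by (simp add: coeff_coord_monomial[OF m i(1)] coeff_coord_monomial[OF m i(2)])
  qed
  have Re: "(\<lambda>v. of_real (Re (monomial r z s v))) =
      (\<lambda>v. 1/2 * coord_monomial (0, s) v + 1/2 * coord_monomial (0, conj_exponents s) v)"
    by (rule ext) (simp add: coord_monomial_zero_fst monomial_conj_exponents complex_eq_iff)
  have Im: "(\<lambda>v. of_real (Im (monomial r z s v))) =
      (\<lambda>v. (- \<i>/2) * coord_monomial (0, s) v + \<i>/2 * coord_monomial (0, conj_exponents s) v)"
    by (rule ext) (simp add: coord_monomial_zero_fst monomial_conj_exponents complex_eq_iff)
  show ?Re unfolding real_coeff_def Re pair by (simp add: distrib_left)
  show ?Im unfolding real_coeff_def Im pair by (simp add: distrib_left)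
qed

text \<open>
  The functional belonging to a generator is the coefficient of its own monomial. Distinct
  generators involve distinct monomials, except that \<open>Re m\<close> and \<open>Im m\<close> share \<open>m\<close> and \<open>cnj m\<close>: there
  the coefficients \<open>1/2\<close> and \<open>-\<i>/2\<close> of \<open>m\<close> are separated by the choice of \<open>\<omega>\<close>.
\<close>
lemma generator_separated:
  assumes M: "conj_representatives r n M" and p: "p \<in> generators M"
  obtains m \<omega> where "indecomposable m" "real_coeff \<omega> m p \<noteq> 0"
    "\<And>q. q \<in> generators M \<Longrightarrow> q \<noteq> p \<Longrightarrow> real_coeff \<omega> m q = 0"
proof -
  note all = subsetD[OF invariant_indices_subset]
  have irr: "s \<in> irreducible_solutions r n" "s \<noteq> conj_exponents s" if "s \<in> M" for s
    using M that unfolding conj_representatives_def by blast+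
  have sol: "s \<in> solutions r n" if "s \<in> M" for s
    using irr[OF that] by (simp add: irreducible_solutions_def)
  have disjoint: "s \<noteq> conj_exponents t" if "s \<in> M" "t \<in> M" for s t
    using conj_representatives_disjoint[OF M that] .
  have unit_eq: "unit_exponent i = unit_exponent j \<longleftrightarrow> i = j" for i j
    by (auto simp: unit_exponent_def fun_eq_iff)
  have unit_nz: "unit_exponent i \<noteq> 0" for i
    by (auto simp: unit_exponent_def fun_eq_iff)
  have self: "s \<noteq> (unit_exponent k, unit_exponent k)"
    "conj_exponents s \<noteq> (unit_exponent k, unit_exponent k)"
    if "s \<in> M" for s k
    using irr(2)[OF that] by (cases s; auto simp: conj_exponents_def)+
  from p show thesis
  proof (cases rule: generators_cases)
    case (lam i)
    let ?m = "(unit_exponent i, 0) :: indices"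
    have m: "?m \<in> all_indices" using lam unit_in_all_indices by blast
    show thesis
    proof (rule that[of ?m 1])
      show "indecomposable ?m" using lam indecomposable_unit by blast
      show "real_coeff 1 ?m p \<noteq> 0" using lam real_coeff_lam[OF _ m] by simp
      fix q assume "q \<in> generators M" "q \<noteq> p"
      then show "real_coeff 1 ?m q = 0"
        by (cases rule: generators_cases)
          (auto simp: lam real_coeff_lam m real_coeff_cmod real_coeff_monomial sol unit_eq unit_nz)
    qed
  next
    case (cmod k)
    let ?m = "(0, (unit_exponent k, unit_exponent k)) :: indices"
    have ind: "indecomposable ?m"
      using cmod weight_pos by (intro indecomposable_irreducible unit_pair_irreducible)
    then have m: "?m \<in> all_indices" using all by (auto simp: indecomposable_def)
    show thesis
    proof (rule that[of ?m 1, OF ind])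
      show "real_coeff 1 ?m p \<noteq> 0" using cmod real_coeff_cmod[OF _ m] by simp
      fix q assume "q \<in> generators M" "q \<noteq> p"
      then show "real_coeff 1 ?m q = 0"
      proof (cases rule: generators_cases)
        case (lam i)
        then show ?thesis using unit_nz[of i] by (simp add: real_coeff_lam m)
      next
        case (cmod j)
        then show ?thesis using \<open>q \<noteq> p\<close> \<open>p = _\<close> by (auto simp: real_coeff_cmod m unit_eq)
      next
        case (Re s)
        then show ?thesis using self[of s k] by (simp add: real_coeff_monomial sol m)
      next
        case (Im s)
        then show ?thesis using self[of s k] by (simp add: real_coeff_monomial sol m)
      qed
    qed
  next
    case (Re s)
    have ind: "indecomposable (0, s)" using Re irr by (intro indecomposable_irreducible)
    then have m: "(0, s) \<in> all_indices" using all by (auto simp: indecomposable_def)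
    show thesis
    proof (rule that[of "(0, s)" 1, OF ind])
      show "real_coeff 1 (0, s) p \<noteq> 0"
        using Re irr(2) by (simp add: real_coeff_monomial sol m)
      fix q assume "q \<in> generators M" "q \<noteq> p"
      then show "real_coeff 1 (0, s) q = 0"
      proof (cases rule: generators_cases)
        case (lam i)
        then show ?thesis using unit_nz[of i] by (simp add: real_coeff_lam m)
      next
        case (cmod j)
        then show ?thesis using self(1)[OF \<open>s \<in> M\<close>] by (simp add: real_coeff_cmod m)
      next
        case (Re t)
        then show ?thesis using \<open>q \<noteq> p\<close> \<open>p = _\<close> disjoint[OF \<open>s \<in> M\<close>, of t]
          by (auto simp: real_coeff_monomial sol m)
      qed (simp add: real_coeff_monomial sol m)
    qed
  next
    case (Im s)
    have ind: "indecomposable (0, s)" using Im irr by (intro indecomposable_irreducible)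
    then have m: "(0, s) \<in> all_indices" using all by (auto simp: indecomposable_def)
    show thesis
    proof (rule that[of "(0, s)" \<i>, OF ind])
      show "real_coeff \<i> (0, s) p \<noteq> 0"
        using Im irr(2) by (simp add: real_coeff_monomial sol m)
      fix q assume "q \<in> generators M" "q \<noteq> p"
      then show "real_coeff \<i> (0, s) q = 0"
      proof (cases rule: generators_cases)
        case (lam i)
        then show ?thesis by (simp add: real_coeff_lam m)
      next
        case (cmod j)
        then show ?thesis by (simp add: real_coeff_cmod m)
      next
        case (Im t)
        then show ?thesis using \<open>q \<noteq> p\<close> \<open>p = _\<close> disjoint[OF \<open>s \<in> M\<close>, of t]
          by (auto simp: real_coeff_monomial sol m)
      qed (simp add: real_coeff_monomial sol m)
    qed
  qed
qed

lemma generators_minimal_integrity_basis: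
  assumes M: "conj_representatives r n M"
  shows "minimal_integrity_basis SO2 \<rho> (generators M)"
proof -
  have M_irr: "M \<subseteq> irreducible_solutions r n"
    using M unfolding conj_representatives_def by blast
  have sub: "generators M \<subseteq> Inv SO2 \<rho>"
    using M_irr irreducible_solutionD by (intro generators_subset_Inv) blast
  have "algebra_gen (generators M) = Inv SO2 \<rho>"
  proof
    show "Inv SO2 \<rho> \<subseteq> algebra_gen (generators M)"
      using M unfolding conj_representatives_def by (intro Inv_subset_algebra_gen) blast
  qed (rule algebra_gen_subset_Inv[OF sub])
  moreover have "finite (generators M)"
    using finite_subset[OF M_irr finite_irreducible_solutions[OF weight_pos]]
        by (rule finite_generators)
  ultimately have "integrity_basis SO2 \<rho> (generators M)"
    using sub homogeneous_generators by (simp add: integrity_basis_def)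
  moreover have False if T: "T \<subset> generators M" "integrity_basis SO2 \<rho> T" for T
  proof -
    obtain p where p: "p \<in> generators M" "p \<notin> T" using T(1) by blast
    then obtain m \<omega> where m: "indecomposable m" "real_coeff \<omega> m p \<noteq> 0"
      "\<And>q. q \<in> generators M \<Longrightarrow> q \<noteq> p \<Longrightarrow> real_coeff \<omega> m q = 0"
      using generator_separated[OF M] by blast
    have "T \<subseteq> Inv SO2 \<rho>" "p \<in> algebra_gen T"
      using p(1) sub T(2) unfolding integrity_basis_def by blast+
    moreover have "real_coeff \<omega> m q = 0" if "q \<in> T" for q
      using that T(1) p(2) by (intro m(3)) blast+
    ultimately have "real_coeff \<omega> m p = 0" using real_coeff_algebra_gen[OF m(1)] by blast
    with m(2) show False ..
  qed
  ultimately show ?thesis unfolding minimal_integrity_basis_def by blast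
qed

end

theorem theorem5p3:
  fixes \<rho> :: "real^2^2 \<Rightarrow> 'v::real_vector \<Rightarrow> 'v"
    and \<nu>\<^sub>0 r :: nat and n :: "nat \<Rightarrow> nat"
    and lam :: "nat \<Rightarrow> 'v \<Rightarrow> real" and z :: "nat \<Rightarrow> 'v \<Rightarrow> complex"
    and M :: "exponents set"
  assumes "real_representation SO2 \<rho>"
    and "\<And>k. k < r \<Longrightarrow> 1 \<le> n k"
    and "harmonic_coordinates \<rho> \<nu>\<^sub>0 r n lam z"
    and "conj_representatives r n M"
  shows "minimal_integrity_basis SO2 \<rho>
     ({lam i | i. i < \<nu>\<^sub>0}
      \<union> {\<lambda>v. (cmod (z k v))\<^sup>2 | k. k < r}
      \<union> {\<lambda>v. Re (monomial r z m v) | m. m \<in> M}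
      \<union> {\<lambda>v. Im (monomial r z m v) | m. m \<in> M})"
proof -
  interpret harmonic_representation \<rho> \<nu>\<^sub>0 r n lam z
    using assms(1-3) by unfold_locales
  show ?thesis
    using generators_minimal_integrity_basis[OF assms(4)] unfolding generators_def .
qed

end
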